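(* Let $n\ge1$, let $\lambda>0$ and put $c=\lambda^{-2/n}$. Then the function $$\phi_c(x)=e^{-\pi c\sum_{j=1}^n\sum_{k=1}^\infty (x_{-k}^j)^2}\in\mathcal S(R_-^n)_\lambda$$ is fixed by the subgroup $K$ of $\widehat{SL_n}(F)$.
   Context: $F=\mathbb R((t))$, $R=\mathbb R[[t]]$, $R_-=\mathbb R[t^{-1}]t^{-1}$, so $F^n=R^n\oplus R_-^n$. A complex-valued function on $R_-^n=\mathbb R^n[t^{-1}]t^{-1}$ is Schwartz if its restriction to every finite-dimensional subspace is a Schwartz function; $\mathcal S(R_-^n)$ is the space of these. Functions on $R_-^n$ are identified with $R^n$-periodic functions on $F^n$ via pull-back along the projection $F^n\to R_-^n$ with kernel $R^n$. An element $x\in R_-^n$ is written $x=\sum_{i\ge1}\sum_{j=1}^n x_{-i}^j e_jt^{-i}$ (finitely many non-zero coordinates; $e_j$ the standard basis of $\mathbb R^n$). $M_n(R)'$ is the semigroup of $n\times n$ matrices over $R$ with non-zero determinant. For $g\in M_n(R)'$, $V_g=g^{-1}R^n/R^n$ (a finite-dimensional real vector space). $\widehat{M_n}(R)'$ is the semigroup of pairs $(g,\mu)$ with $g\in M_n(R)'$ and $\mu$ a Haar measure on $V_g$, with product $(g_1,\mu_1)(g_2,\mu_2)=(g_1g_2,\mu_1\ast\mu_2)$, where $$\int_{V_{g_1g_2}} f(x)\,(\mu_1\ast\mu_2)(dx)=\int_{V_{g_1}}\int_{V_{g_2}} f(g_2^{-1}y+z)\,\mu_2(dz)\,\mu_1(dy).$$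 It acts on $\mathcal S(R_-^n)$ by $\pi(g,\mu)f(x)=\int_{V_g}f(g^{-1}x+y)\,\mu(dy)$. On $V_{t^lI_n}$, $l\ge0$, $\mu_{st}$ is the Haar measure induced by the inner product for which $\{t^{-i}e_j:1\le i\le l,1\le j\le n\}$ is orthonormal. Put $\pi_t=\pi(tI_n,\mu_{st})$ and $\mathcal S(R_-^n)_\lambda=\{f\in\mathcal S(R_-^n):\pi_tf=\lambda f\}$. $GL_n(F)_0=\{g\in GL_n(F):\det g\text{ has leading coefficient }\pm1\}$ (leading coefficient = coefficient of the lowest power of $t$). $\widehat{M_n}(R)_0'$ is the subsemigroup of pairs $(g,\mu)\in\widehat{M_n}(R)'$ with $g\in GL_n(F)_0$. Let $\tilde G=\{t^kI_n:k\in\mathbb Z\}\times\widehat{M_n}(R)_0'$ and let $\sim$ be the equivalence relation generated by $(t^{k+l},\alpha)\sim(t^k,(t^lI_n,\mu_{st})\alpha)$ for $k\in\mathbb Z$, $l\in\mathbb Z_{\ge0}$ (writing $t^k$ for $t^kI_n$). The quotient $\widehat{GL_n}(F)_0:=\tilde G/\!\sim$ is a group, a central extension of $GL_n(F)_0$ by $\mathbb R_{>0}$ via $(t^k,(g,\mu))\mapsto t^kg$; $\widehat{SL_n}(F)$ is the inverse image of $SL_n(F)$. The class of $(t^l,(g,\mu))$ acts on $\mathcal S(R_-^n)_\lambda$ by $\lambda^l\pi(g,\mu)$. Let $O=\{g(t)\in GL_n(\mathbb R[t,t^{-1}]): g(t)\,g(t^{-1})^T=I_n\}$, a subgroup of $GL_n(F)_0$.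 Equip $\mathbb R^n[t,t^{-1}]$ with the inner product $(u,v)=$ constant term of $u(t)^Tv(t^{-1})$, for which $\{e_it^j\}$ is orthonormal. For $g\in O\cap M_n(\mathbb R[t])$ identify $V_g$ with $g^{-1}R^n\cap R_-^n\subset R_-^n$ and let $\mu_g$ be the Haar measure on $V_g$ induced by the restriction of this inner product (an orthonormal basis spans a parallelotope of volume $1$). For $g\in O$ set $s(g)=(t^{-l},(t^lg,\mu_{t^lg}))\in\widehat{GL_n}(F)_0$ for any $l$ large enough that $t^lg\in M_n(\mathbb R[t])$; this is independent of $l$. Then $K=\{s(g):g\in O,\ \det g=1\}$. *)

theory Defs
  imports "HOL-Analysis.Analysis" "HOL-Computational_Algebra.Computational_Algebra"
begin

unbundle fps_syntax

type_synonym 'n Fvec = "(real fls) ^ 'n"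
type_synonym 'n Fmat = "(real fls) ^ 'n ^ 'n"

definition R_ring :: "real fls set" where
  "R_ring = range fps_to_fls"

definition R_vec :: "'n::finite Fvec set" where
  "R_vec = {x. \<forall>j. x $ j \<in> R_ring}"

text \<open>Elements of \<open>R[t\<^sup>-\<^sup>1]t\<^sup>-\<^sup>1\<close> are the Laurent series without regular part; finiteness of the
  principal part is built into the type of Laurent series.\<close>

definition R_minus :: "'n::finite Fvec set" where
  "R_minus = {x. \<forall>j. fls_regpart (x $ j) = 0}"

text \<open>The projection of \<open>F\<^sup>n\<close> onto \<open>R_minus\<close> with kernel \<open>R_vec\<close>.\<close>

definition neg_part :: "'n::finite Fvec \<Rightarrow> 'n Fvec" where
  "neg_part x = (\<chi> j. x $ j - fps_to_fls (fls_regpart (x $ j)))"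

definition rscale :: "real \<Rightarrow> 'n::finite Fvec \<Rightarrow> 'n Fvec" where
  "rscale r x = fls_const r *s x"

interpretation rvs: vector_space "rscale :: real \<Rightarrow> 'n::finite Fvec \<Rightarrow> 'n Fvec"
  by unfold_locales
     (simp_all add: rscale_def vec_eq_iff algebra_simps flip: fls_plus_const)

text \<open>\<open>v 0, \<dots>, v (m - 1)\<close> is a basis of the real vector space \<open>V\<close>; in particular \<open>V\<close> is a
  finite-dimensional real subspace of \<open>F\<^sup>n\<close>.\<close>

definition real_basis :: "'n::finite Fvec set \<Rightarrow> nat \<Rightarrow> (nat \<Rightarrow> 'n Fvec) \<Rightarrow> bool" where
  "real_basis V m v \<longleftrightarrow>
     inj_on v {..<m} \<and> rvs.independent (v ` {..<m}) \<and> rvs.span (v ` {..<m}) = V"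

definition lincomb :: "nat \<Rightarrow> (nat \<Rightarrow> 'n::finite Fvec) \<Rightarrow> (nat \<Rightarrow> real) \<Rightarrow> 'n Fvec" where
  "lincomb m v a = (\<Sum>i<m. rscale (a i) (v i))"

definition partial_deriv :: "nat \<Rightarrow> ((nat \<Rightarrow> real) \<Rightarrow> complex) \<Rightarrow> (nat \<Rightarrow> real) \<Rightarrow> complex" where
  "partial_deriv i h a = vector_derivative (\<lambda>s. h (a(i := s))) (at (a i))"

text \<open>Functions on \<open>\<real>\<^sup>m\<close> are represented by functions of \<open>a :: nat \<Rightarrow> real\<close> that depend only on
  \<open>a 0, \<dots>, a (m - 1)\<close>; for these, continuity for the product topology on \<open>nat \<Rightarrow> real\<close> is
  continuity on \<open>\<real>\<^sup>m\<close>.  The first two conjuncts say that the function is smooth, the third one that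
  every monomial times every partial derivative is bounded.\<close>

definition schwartz :: "nat \<Rightarrow> ((nat \<Rightarrow> real) \<Rightarrow> complex) \<Rightarrow> bool" where
  "schwartz m h \<longleftrightarrow>
     (\<forall>is. set is \<subseteq> {..<m} \<longrightarrow>
        continuous_on UNIV (foldr partial_deriv is h) \<and>
        (\<forall>i<m. \<forall>a. (\<lambda>s. foldr partial_deriv is h (a(i := s))) differentiable at (a i)) \<and>
        (\<forall>e :: nat \<Rightarrow> nat.
           bounded (range (\<lambda>a. (\<Prod>i<m. a i ^ e i) *\<^sub>R foldr partial_deriv is h a))))"

text \<open>Functions on \<open>R_minus\<close> are represented by their \<open>R_vec\<close>-periodic extensions to \<open>F\<^sup>n\<close>.  A function
  on a finite-dimensional real vector space is Schwartz if it is so in linear coordinates.\<close>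

definition schwartz_space :: "('n::finite Fvec \<Rightarrow> complex) set" where
  "schwartz_space = {f.
     (\<forall>x. \<forall>r\<in>R_vec. f (x + r) = f x) \<and>
     (\<forall>W m v. W \<subseteq> R_minus \<and> real_basis W m v \<longrightarrow> schwartz m (\<lambda>a. f (lincomb m v a)))}"

text \<open>The usual topology of a finite-dimensional real subspace \<open>V\<close>: the initial topology for the
  real coordinates \<open>x \<mapsto> x\<^sub>k\<^sup>j\<close>.  (The \<open>t\<close>-adic topology of the library is not the one needed here.)\<close>

definition vtop :: "'n::finite Fvec set \<Rightarrow> 'n Fvec topology" where
  "vtop V = pullback_topology V (\<lambda>x. \<lambda>(j, k). (x $ j) $$ k)
              (euclidean :: ('n \<times> int \<Rightarrow> real) topology)"

text \<open>Regularity is automatic for a locally finite Borel measure on a finite-dimensional space.\<close>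

definition haar_measure :: "'n::finite Fvec set \<Rightarrow> 'n Fvec measure \<Rightarrow> bool" where
  "haar_measure V \<mu> \<longleftrightarrow>
     space \<mu> = V \<and>
     sets \<mu> = sigma_sets V {U. openin (vtop V) U} \<and>
     (\<forall>v\<in>V. \<forall>A\<in>sets \<mu>. emeasure \<mu> ((+) v ` A) = emeasure \<mu> A) \<and>
     (\<forall>C. compactin (vtop V) C \<longrightarrow> emeasure \<mu> C < \<infinity>) \<and>
     emeasure \<mu> V \<noteq> 0"

definition laurent_poly :: "real fls \<Rightarrow> bool" where
  "laurent_poly f \<longleftrightarrow> finite {k. f $$ k \<noteq> 0}"

text \<open>The substitution \<open>t \<mapsto> t\<^sup>-\<^sup>1\<close>; meaningful for Laurent polynomials only.\<close>

definition flip_t :: "real fls \<Rightarrow> real fls" where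
  "flip_t f = Abs_fls (\<lambda>k. f $$ (- k))"

definition laurent_inner :: "'n::finite Fvec \<Rightarrow> 'n Fvec \<Rightarrow> real" where
  "laurent_inner u v = (\<Sum>j\<in>UNIV. u $ j * flip_t (v $ j)) $$ 0"

definition orthonormal_basis :: "'n::finite Fvec set \<Rightarrow> nat \<Rightarrow> (nat \<Rightarrow> 'n Fvec) \<Rightarrow> bool" where
  "orthonormal_basis V m v \<longleftrightarrow> real_basis V m v \<and>
     (\<forall>i<m. \<forall>j<m. laurent_inner (v i) (v j) = (if i = j then 1 else 0))"

text \<open>The Haar measure on a finite-dimensional subspace \<open>V\<close> of \<open>\<real>\<^sup>n[t,t\<^sup>-\<^sup>1]\<close> induced by the inner
  product: parallelotopes spanned by orthonormal bases have volume \<open>1\<close>.\<close>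

definition induced_haar :: "'n::finite Fvec set \<Rightarrow> 'n Fvec measure" where
  "induced_haar V = (THE \<mu>. haar_measure V \<mu> \<and>
     (\<forall>m v. orthonormal_basis V m v \<longrightarrow>
        emeasure \<mu> {lincomb m v a | a. \<forall>i<m. 0 \<le> a i \<and> a i \<le> 1} = 1))"

definition Mat_R :: "'n::finite Fmat set" where
  "Mat_R = {g. (\<forall>i j. g $ i $ j \<in> R_ring) \<and> det g \<noteq> 0}"

text \<open>\<open>g\<^sup>-\<^sup>1R\<^sup>n/R\<^sup>n\<close> is a subspace of \<open>F\<^sup>n/R\<^sup>n\<close>, which is identified with \<open>R_minus\<close>; since
  \<open>R\<^sup>n \<subseteq> g\<^sup>-\<^sup>1R\<^sup>n\<close>, it becomes \<open>g\<^sup>-\<^sup>1R\<^sup>n \<inter> R_minus\<close>.\<close>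

definition Vsp :: "'n::finite Fmat \<Rightarrow> 'n Fvec set" where
  "Vsp g = ((*v) (matrix_inv g)) ` R_vec \<inter> R_minus"

definition Mhat :: "('n::finite Fmat \<times> 'n Fvec measure) set" where
  "Mhat = {(g, \<mu>). g \<in> Mat_R \<and> haar_measure (Vsp g) \<mu>}"

text \<open>The measure of \<open>A\<close> is the iterated integral of the (periodic) indicator function of \<open>A\<close> at
  \<open>g\<^sub>2\<^sup>-\<^sup>1y + z\<close>.\<close>

fun Mhat_mult :: "'n::finite Fmat \<times> 'n Fvec measure \<Rightarrow> 'n Fmat \<times> 'n Fvec measure
    \<Rightarrow> 'n Fmat \<times> 'n Fvec measure" where
  "Mhat_mult (g1, \<mu>1) (g2, \<mu>2) =
     (g1 ** g2,
      measure_of (Vsp (g1 ** g2)) {U. openin (vtop (Vsp (g1 ** g2))) U}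
        (\<lambda>A. \<integral>\<^sup>+ y. (\<integral>\<^sup>+ z. indicator A (neg_part (matrix_inv g2 *v y + z)) \<partial>\<mu>2) \<partial>\<mu>1))"

fun rep :: "'n::finite Fmat \<times> 'n Fvec measure \<Rightarrow> ('n Fvec \<Rightarrow> complex) \<Rightarrow> 'n Fvec \<Rightarrow> complex" where
  "rep (g, \<mu>) f x = (LINT y|\<mu>. f (matrix_inv g *v x + y))"

definition tI :: "int \<Rightarrow> 'n::finite Fmat" where
  "tI k = mat (fls_X_intpow k)"

text \<open>On \<open>Vsp (tI l)\<close> the inner product \<^const>\<open>laurent_inner\<close> is the one for which the vectors
  \<open>t\<^sup>-\<^sup>ie\<^sub>j\<close>, \<open>1 \<le> i \<le> l\<close>, are orthonormal.\<close>

definition tI_st :: "nat \<Rightarrow> 'n::finite Fmat \<times> 'n Fvec measure" where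
  "tI_st l = (tI (int l), induced_haar (Vsp (tI (int l))))"

definition schwartz_eigenspace :: "real \<Rightarrow> ('n::finite Fvec \<Rightarrow> complex) set" where
  "schwartz_eigenspace lam =
     {f \<in> schwartz_space. rep (tI_st 1) f = (\<lambda>x. complex_of_real lam * f x)}"

definition GL0 :: "'n::finite Fmat set" where
  "GL0 = {g. det g \<noteq> 0 \<and> det g $$ fls_subdegree (det g) \<in> {1, -1}}"

definition Mhat0 :: "('n::finite Fmat \<times> 'n Fvec measure) set" where
  "Mhat0 = {(g, \<mu>) \<in> Mhat. g \<in> GL0}"

text \<open>The pair \<open>(t\<^sup>kI\<^sub>n, \<alpha>)\<close> is represented by \<open>(k, \<alpha>)\<close>.\<close>

definition Gtilde :: "(int \<times> ('n::finite Fmat \<times> 'n Fvec measure)) set" where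
  "Gtilde = UNIV \<times> Mhat0"

definition gen_rel :: "int \<times> ('n::finite Fmat \<times> 'n Fvec measure)
    \<Rightarrow> int \<times> ('n Fmat \<times> 'n Fvec measure) \<Rightarrow> bool" where
  "gen_rel a b \<longleftrightarrow> (\<exists>k l. \<exists>\<alpha>\<in>Mhat0. a = (k + int l, \<alpha>) \<and> b = (k, Mhat_mult (tI_st l) \<alpha>))"

definition ext_rel :: "((int \<times> ('n::finite Fmat \<times> 'n Fvec measure))
    \<times> (int \<times> ('n Fmat \<times> 'n Fvec measure))) set" where
  "ext_rel = {(a, b). a \<in> Gtilde \<and> b \<in> Gtilde \<and> equivclp gen_rel a b}"

definition GLhat :: "(int \<times> ('n::finite Fmat \<times> 'n Fvec measure)) set set" where
  "GLhat = Gtilde // ext_rel"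

definition SLhat :: "(int \<times> ('n::finite Fmat \<times> 'n Fvec measure)) set set" where
  "SLhat = {C \<in> GLhat. \<exists>k g \<mu>. (k, (g, \<mu>)) \<in> C \<and> det (tI k ** g) = 1}"

text \<open>The action of a class is the common value of \<open>\<lambda>\<^sup>l\<pi>(g,\<mu>)\<close> on all its representatives
  \<open>(t\<^sup>l,(g,\<mu>))\<close>.\<close>

definition act :: "real \<Rightarrow> (int \<times> ('n::finite Fmat \<times> 'n Fvec measure)) set
    \<Rightarrow> ('n Fvec \<Rightarrow> complex) \<Rightarrow> 'n Fvec \<Rightarrow> complex" where
  "act lam C f = (THE h. \<exists>(l, \<alpha>)\<in>C. h = (\<lambda>x. complex_of_real (lam powi l) * rep \<alpha> f x))"

definition GL_laurent :: "'n::finite Fmat set" where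
  "GL_laurent = {g. (\<forall>i j. laurent_poly (g $ i $ j)) \<and>
     (\<exists>h. (\<forall>i j. laurent_poly (h $ i $ j)) \<and> g ** h = mat 1 \<and> h ** g = mat 1)}"

definition O_grp :: "'n::finite Fmat set" where
  "O_grp = {g \<in> GL_laurent. g ** transpose (\<chi> i j. flip_t (g $ i $ j)) = mat 1}"

definition Mat_poly :: "'n::finite Fmat set" where
  "Mat_poly = {g. \<forall>i j. g $ i $ j \<in> range (\<lambda>p. fps_to_fls (fps_of_poly p))}"

text \<open>The class \<open>s(g)\<close> does not depend on \<open>l\<close>; here all admissible \<open>l\<close> are used simultaneously.\<close>

definition K_grp :: "(int \<times> ('n::finite Fmat \<times> 'n Fvec measure)) set set" where
  "K_grp = {ext_rel `` {(- l, (tI l ** g, induced_haar (Vsp (tI l ** g))))} | l g.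
     g \<in> O_grp \<and> det g = 1 \<and> tI l ** g \<in> Mat_poly}"

definition gaussian :: "real \<Rightarrow> 'n::finite Fvec \<Rightarrow> complex" where
  "gaussian c x = complex_of_real
     (exp (- pi * c * (\<Sum>j\<in>UNIV. \<Sum>k. ((x $ j) $$ (- int (Suc k)))\<^sup>2)))"

end

theory Submission
  imports Defs "HOL-Probability.Distributions"
begin

text \<open>
  The Gaussian is multiplicative on orthogonal sums, and a loop \<open>h\<close> that is orthogonal and polynomial
  in \<open>t\<close> turns the integral that defines its action into such a sum.  The adjoint of multiplication
  by \<open>h\<close> is multiplication by the transpose of \<open>h(1/t)\<close>, which is the inverse of \<open>h\<close> and is
  polynomial in \<open>1/t\<close>.  So the inverse maps principal parts isometrically to principal parts, and its
  image is orthogonal to \<open>V\<^sub>h\<close>, because \<open>h\<close> maps \<open>V\<^sub>h\<close> to regular vectors.  Therefore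
  \<open>\<pi>(h,\<mu>)\<phi>\<^sub>c\<close> is \<open>\<phi>\<^sub>c\<close> times the integral of \<open>\<phi>\<^sub>c\<close> over \<open>V\<^sub>h\<close>, for every Haar measure
  \<open>\<mu>\<close> on \<open>V\<^sub>h\<close> (lemmas \<open>nn_integral_gauss_inv\<close> and \<open>rep_gaussian_haar\<close>).

  In orthonormal coordinates \<open>\<mu>\<^sub>h\<close> is Lebesgue measure, so for \<open>\<mu>\<^sub>h\<close> the eigenvalue is
  \<open>c\<close> to the power \<open>-d/2\<close> with \<open>d = dim V\<^sub>h\<close>.  This dimension is the order of \<open>det h\<close>
  (lemma \<open>dim_eq_degree\<close>): the principal parts are the orthogonal sum of \<open>V\<^sub>h\<close> and their own image
  under the inverse of \<open>h\<close>, and the trace of the projection to \<open>V\<^sub>h\<close>, computed on monomials, is the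
  constant term of the trace of \<open>(t dh/dt)\<close> times the inverse of \<open>h\<close>, which is the logarithmic derivative
  of \<open>det h\<close> by Jacobi's formula.  If \<open>det h\<close> is \<open>t\<close> to the power \<open>n l\<close>, the choice of \<open>c\<close> makes the
  eigenvalue \<open>\<lambda>\<close> to the power \<open>l\<close>.  For \<open>h = t I\<close> this puts \<open>\<phi>\<^sub>c\<close> into the eigenspace, and for a
  shifted loop \<open>t^l g\<close> with \<open>det g = 1\<close> it cancels the factor of exponent \<open>-l\<close> in the action of \<open>s(g)\<close>.

  The value of a class must not depend on the representative.  All representatives \<open>(k, (h, \<mu>))\<close> of
  \<open>s(g)\<close> have \<open>h\<close> equal to \<open>g\<close> times the power \<open>-k\<close> of \<open>t\<close>, so \<open>\<phi>\<^sub>c\<close> is an eigenvector of each of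
  them, and multiplication by \<open>(t^l I, \<mu>\<^sub>s\<^sub>t)\<close> multiplies the eigenvalue by \<open>\<lambda>^l\<close> (lemma
  \<open>rep_gaussian_convolution\<close>).  Hence invariance of \<open>\<phi>\<^sub>c\<close> passes along the generating relation in both
  directions (lemma \<open>gen_rel_gaussian\<close>).

  Existence and uniqueness of \<open>\<mu>\<^sub>h\<close> come from Gram-Schmidt, Lebesgue measure on coordinate space and a
  Fubini argument (lemmas \<open>haar_unique\<close> and \<open>induced_haar_eq\<close>).  The Schwartz property holds because
  in linear coordinates the Gaussian is the exponential of a negative definite quadratic form, whose
  derivatives are polynomial multiples of it (lemma \<open>gaussian_schwartz\<close>).
\<close>

(* Leaves the notation $ to the components of vectors. *)
unbundle no Formal_Power_Series.fps_syntax

section \<open>Laurent polynomials and the inner product\<close>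

text \<open>Without finite support the reflected coefficients need not belong to a Laurent series.\<close>

lemma flip_t_nth:
  assumes "laurent_poly f"
  shows "flip_t f $$ k = f $$ (- k)"
proof -
  have "finite {n. f $$ (int n) \<noteq> 0}"
    using finite_vimageI[OF assms[unfolded laurent_poly_def], of int]
    by (simp add: vimage_def)
  then have "\<forall>\<^sub>\<infinity>n. f $$ (- (- int n)) = 0"
    by (simp add: eventually_cofinite)
  then show ?thesis
    unfolding flip_t_def by simp
qed

lemma laurent_polyI:
  assumes "finite S" "\<And>k. k \<notin> S \<Longrightarrow> f $$ k = 0"
  shows "laurent_poly f"
  unfolding laurent_poly_def by (rule finite_subset[OF _ assms(1)]) (use assms(2) in auto)

text \<open>The range is any finite set that contains the support of one factor, so that the sums for all entries
  of a matrix can be taken over the same range.\<close>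

lemma fls_times_nth_finite:
  fixes f g :: "'a::comm_ring_1 fls"
  assumes "finite S" "\<And>k. k \<notin> S \<Longrightarrow> f $$ k = 0"
  shows "(f * g) $$ n = (\<Sum>k\<in>S. f $$ k * g $$ (n - k))"
proof -
  have "f = (\<Sum>k\<in>S. fls_const (f $$ k) * fls_X_intpow k)"
  proof (rule fls_eqI)
    fix i
    have "(\<Sum>k\<in>S. fls_const (f $$ k) * fls_X_intpow k) $$ i = (\<Sum>k\<in>S. if i = k then f $$ k else 0)"
      unfolding fls_nth_sum by (intro sum.cong refl) (auto simp: fls_X_intpow_times_conv_shift)
    also have "\<dots> = f $$ i"
      using assms by (simp add: sum.delta)
    finally show "f $$ i = (\<Sum>k\<in>S. fls_const (f $$ k) * fls_X_intpow k) $$ i" by simp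
  qed
  then have "f * g = (\<Sum>k\<in>S. fls_const (f $$ k) * fls_X_intpow k) * g" by simp
  also have "\<dots> = (\<Sum>k\<in>S. fls_const (f $$ k) * fls_shift (- k) g)"
    by (simp only: sum_distrib_right mult.assoc fls_X_intpow_times_conv_shift(1))
  finally show ?thesis
    by (simp add: fls_nth_sum)
qed

lemma laurent_poly_flip: "laurent_poly f \<Longrightarrow> laurent_poly (flip_t f)"
  by (rule laurent_polyI[of "uminus ` {k. f $$ k \<noteq> 0}"])
     (auto simp: flip_t_nth laurent_poly_def image_iff dest!: spec[of _ "- _"])

lemma laurent_poly_0 [simp]: "laurent_poly 0"
  by (simp add: laurent_poly_def)

lemma laurent_poly_X_intpow [simp]: "laurent_poly (fls_X_intpow k)"
  by (rule laurent_polyI[of "{k}"]) auto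

lemma laurent_poly_const [simp]: "laurent_poly (fls_const r)"
  by (rule laurent_polyI[of "{0}"]) auto

lemma laurent_poly_add: "laurent_poly f \<Longrightarrow> laurent_poly g \<Longrightarrow> laurent_poly (f + g)"
  by (rule laurent_polyI[of "{k. f $$ k \<noteq> 0} \<union> {k. g $$ k \<noteq> 0}"]) (auto simp: laurent_poly_def)

lemma laurent_poly_sum: "(\<And>i. i \<in> A \<Longrightarrow> laurent_poly (f i)) \<Longrightarrow> laurent_poly (sum f A)"
  by (induction A rule: infinite_finite_induct) (auto intro: laurent_poly_add)

lemma laurent_poly_mult:
  assumes "laurent_poly f" "laurent_poly g"
  shows "laurent_poly (f * g)"
proof (rule laurent_polyI)
  let ?S = "{k. f $$ k \<noteq> 0}" and ?T = "{k. g $$ k \<noteq> 0}"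
  show "finite ((\<lambda>(a, b). a + b) ` (?S \<times> ?T))"
    using assms by (simp add: laurent_poly_def)
  fix n assume n: "n \<notin> (\<lambda>(a, b). a + b) ` (?S \<times> ?T)"
  have "(f * g) $$ n = (\<Sum>k\<in>?S. f $$ k * g $$ (n - k))"
    by (rule fls_times_nth_finite) (use assms in \<open>auto simp: laurent_poly_def\<close>)
  also have "\<dots> = 0"
  proof (rule sum.neutral, rule ballI)
    fix k assume "k \<in> ?S"
    then have "n - k \<notin> ?T" using n by force
    then show "f $$ k * g $$ (n - k) = 0" by simp
  qed
  finally show "(f * g) $$ n = 0" .
qed

lemma flip_t_add: "laurent_poly f \<Longrightarrow> laurent_poly g \<Longrightarrow> flip_t (f + g) = flip_t f + flip_t g"
  by (rule fls_eqI) (simp add: flip_t_nth laurent_poly_add)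

lemma flip_t_0 [simp]: "flip_t 0 = 0"
  by (rule fls_eqI) (simp add: flip_t_nth)

lemma flip_t_const [simp]: "flip_t (fls_const r) = fls_const r"
  by (rule fls_eqI) (simp add: flip_t_nth)

lemma flip_t_X_intpow [simp]: "flip_t (fls_X_intpow k) = fls_X_intpow (- k)"
  by (rule fls_eqI) (auto simp: flip_t_nth)

lemma flip_t_sum: "(\<And>i. i \<in> A \<Longrightarrow> laurent_poly (f i)) \<Longrightarrow> flip_t (sum f A) = (\<Sum>i\<in>A. flip_t (f i))"
  by (induction A rule: infinite_finite_induct) (auto simp: flip_t_add laurent_poly_sum)

lemma flip_t_mult:
  assumes "laurent_poly f" "laurent_poly g"
  shows "flip_t (f * g) = flip_t f * flip_t g"
proof (rule fls_eqI)
  fix n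
  let ?S = "{k. f $$ k \<noteq> 0}"
  have fin: "finite ?S" using assms(1) by (simp add: laurent_poly_def)
  have "flip_t (f * g) $$ n = (f * g) $$ (- n)"
    by (simp add: flip_t_nth laurent_poly_mult assms)
  also have "\<dots> = (\<Sum>k\<in>?S. f $$ k * g $$ (- n - k))"
    by (rule fls_times_nth_finite) (use fin in auto)
  also have "\<dots> = (\<Sum>k\<in>uminus ` ?S. flip_t f $$ k * flip_t g $$ (n - k))"
    by (subst sum.reindex) (auto simp: flip_t_nth assms intro!: sum.cong arg_cong[where f = "fls_nth g"])
  also have "\<dots> = (flip_t f * flip_t g) $$ n"
  proof (rule fls_times_nth_finite[symmetric])
    show "finite (uminus ` ?S)" using fin by simp
    show "\<And>k. k \<notin> uminus ` ?S \<Longrightarrow> flip_t f $$ k = 0"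
      using assms(1) by (auto simp: flip_t_nth image_iff dest!: spec[of _ "- _"])
  qed
  finally show "flip_t (f * g) $$ n = (flip_t f * flip_t g) $$ n" .
qed

definition laurent_vec :: "'n::finite Fvec \<Rightarrow> bool" where
  "laurent_vec x \<longleftrightarrow> (\<forall>j. laurent_poly (x $ j))"

text \<open>One range serves all components, and the support of \<open>u\<close> may be infinite: this makes the inner
  product with a fixed vector a finite linear combination of coefficients.\<close>

lemma laurent_inner_nth:
  assumes "finite S" "\<And>j k. k \<notin> S \<Longrightarrow> v $ j $$ k = 0"
  shows "laurent_inner u v = (\<Sum>j\<in>UNIV. \<Sum>k\<in>S. u $ j $$ k * v $ j $$ k)"
  unfolding laurent_inner_def fls_nth_sum
proof (rule sum.cong[OF refl])
  fix j :: 'a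
  have lp: "laurent_poly (v $ j)" by (rule laurent_polyI[OF assms(1)]) (rule assms(2))
  have "(u $ j * flip_t (v $ j)) $$ 0 = (flip_t (v $ j) * u $ j) $$ 0" by (simp add: mult.commute)
  also have "\<dots> = (\<Sum>k\<in>uminus ` S. flip_t (v $ j) $$ k * u $ j $$ (0 - k))"
  proof (rule fls_times_nth_finite)
    show "\<And>k. k \<notin> uminus ` S \<Longrightarrow> flip_t (v $ j) $$ k = 0"
      using assms(2) by (auto simp: flip_t_nth lp image_iff) (metis add.inverse_inverse)
  qed (use assms in auto)
  also have "\<dots> = (\<Sum>k\<in>S. u $ j $$ k * v $ j $$ k)"
    by (subst sum.reindex) (auto simp: flip_t_nth lp mult.commute)
  finally show "(u $ j * flip_t (v $ j)) $$ 0 = (\<Sum>k\<in>S. u $ j $$ k * v $ j $$ k)" .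
qed

lemma laurent_vec_support:
  assumes "laurent_vec v"
  obtains S where "finite S" "\<And>j k. k \<notin> S \<Longrightarrow> v $ j $$ k = 0"
proof
  show "finite (\<Union>j. {k. v $ j $$ k \<noteq> 0})"
    using assms by (auto simp: laurent_vec_def laurent_poly_def)
qed auto

lemma rscale_nth [simp]: "rscale r x $ j $$ k = r * x $ j $$ k"
  by (simp add: rscale_def)

lemma Fvec_sum_nth: "(\<Sum>i\<in>A. f i) $ j $$ k = (\<Sum>i\<in>A. f i $ j $$ k)"
  by (simp add: fls_nth_sum)

lemma laurent_inner_commute:
  assumes "laurent_vec u" "laurent_vec v"
  shows "laurent_inner u v = laurent_inner v u"
proof -
  obtain S where S: "finite S" "\<And>j k. k \<notin> S \<Longrightarrow> u $ j $$ k = 0"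
    using laurent_vec_support[OF assms(1)] by blast
  obtain T where T: "finite T" "\<And>j k. k \<notin> T \<Longrightarrow> v $ j $$ k = 0"
    using laurent_vec_support[OF assms(2)] by blast
  show ?thesis
    by (subst (1 2) laurent_inner_nth[of "S \<union> T"]) (use S T in \<open>auto simp: mult.commute\<close>)
qed

lemma laurent_inner_add_left: "laurent_inner (u + u') v = laurent_inner u v + laurent_inner u' v"
  by (simp add: laurent_inner_def distrib_right sum.distrib)

lemma laurent_inner_rscale_left: "laurent_inner (rscale r u) v = r * laurent_inner u v"
  by (simp add: laurent_inner_def rscale_def mult.assoc flip: sum_distrib_left)

lemma laurent_inner_zero_left [simp]: "laurent_inner 0 v = 0"
  by (simp add: laurent_inner_def)

lemma laurent_inner_diff_left: "laurent_inner (u - u') v = laurent_inner u v - laurent_inner u' v"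
  using laurent_inner_add_left[of "u - u'" u' v] by simp

lemma laurent_inner_sum_left:
  "laurent_inner (\<Sum>i\<in>A. u i) v = (\<Sum>i\<in>A. laurent_inner (u i) v)"
  by (induction A rule: infinite_finite_induct) (auto simp: laurent_inner_add_left)

lemma laurent_inner_add_right:
  "laurent_vec v \<Longrightarrow> laurent_vec v' \<Longrightarrow> laurent_inner u (v + v') = laurent_inner u v + laurent_inner u v'"
  by (simp add: laurent_inner_def laurent_vec_def flip_t_add distrib_left sum.distrib)

lemma laurent_inner_rscale_right:
  "laurent_vec v \<Longrightarrow> laurent_inner u (rscale r v) = r * laurent_inner u v"
  by (simp add: laurent_inner_def laurent_vec_def rscale_def flip_t_mult mult.left_commute
      flip: sum_distrib_left)

section \<open>Principal parts\<close>

lemma R_ring_iff: "f \<in> R_ring \<longleftrightarrow> (\<forall>k<0. f $$ k = 0)"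
proof
  assume "\<forall>k<0. f $$ k = 0"
  then have "f = fps_to_fls (fls_regpart f)"
    by (intro fls_eqI) simp
  then show "f \<in> R_ring" unfolding R_ring_def by blast
qed (auto simp: R_ring_def)

lemma R_vec_iff: "x \<in> R_vec \<longleftrightarrow> (\<forall>j k. k < 0 \<longrightarrow> x $ j $$ k = 0)"
  by (simp add: R_vec_def R_ring_iff)

lemma R_minus_iff: "x \<in> R_minus \<longleftrightarrow> (\<forall>j k. 0 \<le> k \<longrightarrow> x $ j $$ k = 0)"
proof -
  have "fls_regpart f = 0 \<longleftrightarrow> (\<forall>k\<ge>0. f $$ k = 0)" for f :: "real fls"
    by (auto simp: fps_eq_iff) (metis int_nat_eq)
  then show ?thesis by (simp add: R_minus_def)
qed

lemma neg_part_nth [simp]: "neg_part x $ j $$ k = (if k < 0 then x $ j $$ k else 0)"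
  by (simp add: neg_part_def)

lemma neg_part_in [simp]: "neg_part x \<in> R_minus"
  by (simp add: R_minus_iff)

lemma diff_neg_part_in: "x - neg_part x \<in> R_vec"
  by (simp add: R_vec_iff)

lemma Fvec_eqI: "(\<And>j k. x $ j $$ k = y $ j $$ k) \<Longrightarrow> x = (y :: 'n::finite Fvec)"
  by (auto simp: vec_eq_iff intro: fls_eqI)

lemma neg_part_eq: "x \<in> R_minus \<Longrightarrow> neg_part x = x"
  by (rule Fvec_eqI) (auto simp: R_minus_iff)

lemma R_minus_laurent_vec:
  assumes "x \<in> R_minus"
  shows "laurent_vec x"
  unfolding laurent_vec_def
proof
  fix j
  show "laurent_poly (x $ j)"
    by (rule laurent_polyI[of "{fls_subdegree (x $ j)..<0}"]) (use assms in \<open>auto simp: R_minus_iff\<close>)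
qed

lemma R_minus_subspace: "rvs.subspace R_minus"
  by (simp add: rvs.subspace_def R_minus_iff)

lemma R_minus_0: "0 \<in> R_minus"
  and R_minus_add: "x \<in> R_minus \<Longrightarrow> y \<in> R_minus \<Longrightarrow> x + y \<in> R_minus"
  and R_minus_diff: "x \<in> R_minus \<Longrightarrow> y \<in> R_minus \<Longrightarrow> x - y \<in> R_minus"
  and R_minus_rscale: "x \<in> R_minus \<Longrightarrow> rscale r x \<in> R_minus"
  by (simp_all add: R_minus_iff)

lemma R_minus_support:
  assumes "x \<in> R_minus"
  obtains N where "\<And>j k. k \<notin> (\<lambda>i. - int (Suc i)) ` {..<N} \<Longrightarrow> x $ j $$ k = 0"
proof -
  obtain S where S: "finite S" "\<And>j k. k \<notin> S \<Longrightarrow> x $ j $$ k = 0"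
    using laurent_vec_support[OF R_minus_laurent_vec[OF assms]] by blast
  obtain N where N: "\<And>k. k \<in> S \<Longrightarrow> - k \<le> int N"
  proof -
    have "finite ((\<lambda>k. nat (- k)) ` S)" using S by simp
    then obtain N where "\<forall>m \<in> (\<lambda>k. nat (- k)) ` S. m \<le> N"
      using finite_nat_set_iff_bounded_le by blast
    then show ?thesis by (intro that[of N]) force
  qed
  show ?thesis
  proof
    fix j k assume "k \<notin> (\<lambda>i. - int (Suc i)) ` {..<N}"
    then have "k \<ge> 0 \<or> k \<notin> S"
    proof (cases "k \<ge> 0")
      case False
      have "k \<notin> S"
      proof
        assume "k \<in> S"
        then have "- k \<le> int N" by (rule N)
        then have "nat (- k - 1) < N \<and> k = - int (Suc (nat (- k - 1)))"
          using False by auto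
        then show False using \<open>k \<notin> _\<close> by blast
      qed
      then show ?thesis ..
    qed simp
    then show "x $ j $$ k = 0" using assms S by (auto simp: R_minus_iff)
  qed
qed

text \<open>The squared norm of the principal part; it is defined on all of \<open>F\<^sup>n\<close> because the action evaluates
  the Gaussian at vectors with a regular part.\<close>

definition nsq :: "'n::finite Fvec \<Rightarrow> real" where
  "nsq x = (\<Sum>j\<in>UNIV. \<Sum>k. (x $ j $$ (- int (Suc k)))\<^sup>2)"

lemma nsq_eq_inner: "nsq x = laurent_inner (neg_part x) (neg_part x)"
proof -
  obtain N where N: "\<And>j k. k \<notin> (\<lambda>i. - int (Suc i)) ` {..<N} \<Longrightarrow> neg_part x $ j $$ k = 0"
    using R_minus_support[of "neg_part x"] by force
  have inj: "inj_on (\<lambda>i. - int (Suc i)) A" for A by (auto simp: inj_on_def)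
  have "laurent_inner (neg_part x) (neg_part x) =
      (\<Sum>j\<in>UNIV. \<Sum>k\<in>(\<lambda>i. - int (Suc i)) ` {..<N}. neg_part x $ j $$ k * neg_part x $ j $$ k)"
    by (rule laurent_inner_nth[OF _ N]) auto
  also have "\<dots> = (\<Sum>j\<in>UNIV. \<Sum>k<N. (x $ j $$ (- int (Suc k)))\<^sup>2)"
    by (subst sum.reindex[OF inj]) (simp add: power2_eq_square)
  also have "\<dots> = nsq x"
    unfolding nsq_def
  proof (rule sum.cong[OF refl])
    fix j :: 'a
    show "(\<Sum>k<N. (x $ j $$ (- int (Suc k)))\<^sup>2) = (\<Sum>k. (x $ j $$ (- int (Suc k)))\<^sup>2)"
    proof (rule suminf_finite[symmetric])
      fix k assume "k \<notin> {..<N}"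
      then have "- int (Suc k) \<notin> (\<lambda>i. - int (Suc i)) ` {..<N}" by auto
      then show "(x $ j $$ (- int (Suc k)))\<^sup>2 = 0" using N[of "- int (Suc k)" j] by simp
    qed simp
  qed
  finally show ?thesis ..
qed

lemma nsq_R_minus: "x \<in> R_minus \<Longrightarrow> nsq x = laurent_inner x x"
  by (simp add: nsq_eq_inner neg_part_eq)

lemma neg_part_cong_R_vec: "r \<in> R_vec \<Longrightarrow> neg_part (x + r) = neg_part x"
  by (rule Fvec_eqI) (simp add: R_vec_iff)

lemma nsq_periodic: "r \<in> R_vec \<Longrightarrow> nsq (x + r) = nsq x"
  by (simp add: nsq_eq_inner neg_part_cong_R_vec)

lemma nsq_neg_part [simp]: "nsq (neg_part x) = nsq x"
  by (simp add: nsq_eq_inner neg_part_eq)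

lemma nsq_nonneg [simp]: "0 \<le> nsq x"
proof -
  obtain N where N: "\<And>j k. k \<notin> (\<lambda>i. - int (Suc i)) ` {..<N} \<Longrightarrow> neg_part x $ j $$ k = 0"
    using R_minus_support[of "neg_part x"] by force
  show ?thesis
    unfolding nsq_eq_inner
    by (subst laurent_inner_nth[OF _ N]) (auto intro!: sum_nonneg)
qed

lemma nsq_eq_0:
  assumes "x \<in> R_minus" "nsq x = 0"
  shows "x = 0"
proof (rule Fvec_eqI)
  fix j k
  obtain N where N: "\<And>j k. k \<notin> (\<lambda>i. - int (Suc i)) ` {..<N} \<Longrightarrow> x $ j $$ k = 0"
    using R_minus_support[OF assms(1)] by blast
  let ?S = "(\<lambda>i. - int (Suc i)) ` {..<N}"
  have "(\<Sum>j\<in>UNIV. \<Sum>k\<in>?S. x $ j $$ k * x $ j $$ k) = 0"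
    using assms by (subst laurent_inner_nth[of ?S x x, symmetric]) (use N in \<open>auto simp: nsq_R_minus\<close>)
  then have "\<forall>j. \<forall>k\<in>?S. x $ j $$ k * x $ j $$ k = 0"
    by (simp add: sum_nonneg_eq_0_iff sum_nonneg)
  then show "x $ j $$ k = 0 $ j $$ k" using N[of k j] by auto
qed

lemma nsq_add_orthogonal:
  assumes "x \<in> R_minus" "y \<in> R_minus" "laurent_inner x y = 0"
  shows "nsq (x + y) = nsq x + nsq y"
proof -
  have lv: "laurent_vec x" "laurent_vec y" using assms R_minus_laurent_vec by blast+
  then have "laurent_inner y x = 0" using assms laurent_inner_commute by metis
  then show ?thesis
    using assms lv
    by (simp add: nsq_R_minus R_minus_add laurent_inner_add_left laurent_inner_add_right)
qed

lemma R_vec_R_minus_orthogonal: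
  assumes "r \<in> R_vec" "y \<in> R_minus"
  shows "laurent_inner r y = 0"
proof -
  obtain S where S: "finite S" "\<And>j k. k \<notin> S \<Longrightarrow> y $ j $$ k = 0"
    using laurent_vec_support[OF R_minus_laurent_vec[OF assms(2)]] by blast
  have *: "r $ j $$ k * y $ j $$ k = 0" for j k
    using assms by (cases "k < 0") (auto simp: R_vec_iff R_minus_iff)
  then show ?thesis
    using laurent_inner_nth[OF S, where u = r] unfolding * by simp
qed

section \<open>Unitary Laurent matrices\<close>

text \<open>The adjoint of multiplication by \<open>h\<close>.\<close>

definition flip_transpose :: "'n::finite Fmat \<Rightarrow> 'n Fmat" where
  "flip_transpose h = transpose (\<chi> i j. flip_t (h $ i $ j))"

text \<open>The condition is the same for \<open>g\<close> and for all \<open>t^k g\<close>, so that orthogonal loops and their polynomial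
  shifts are treated together.\<close>

definition unitary_loop :: "'n::finite Fmat \<Rightarrow> bool" where
  "unitary_loop h \<longleftrightarrow> (\<forall>i j. laurent_poly (h $ i $ j)) \<and> h ** flip_transpose h = mat 1"

lemma flip_transpose_nth [simp]: "flip_transpose h $ i $ j = flip_t (h $ j $ i)"
  by (simp add: flip_transpose_def transpose_def)

lemma matrix_inv_eq_right_inverse:
  fixes A :: "'a::field ^ 'n ^ 'n"
  assumes "A ** B = mat 1"
  shows "matrix_inv A = B"
proof -
  have B: "B ** A = mat 1" using assms matrix_left_right_inverse by blast
  have "A ** matrix_inv A = mat 1 \<and> matrix_inv A ** A = mat 1"
    unfolding matrix_inv_def by (rule someI[of _ B]) (use assms B in auto)
  then have "B ** (A ** matrix_inv A) = B" by simp
  then show ?thesis using B by (simp add: matrix_mul_assoc)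
qed

lemma unitary_loop_inv:
  assumes "unitary_loop h"
  shows "matrix_inv h = flip_transpose h"
    and "flip_transpose h ** h = mat 1"
  using assms matrix_inv_eq_right_inverse matrix_left_right_inverse
  by (auto simp: unitary_loop_def)

lemma laurent_vec_mult:
  assumes "\<And>i j. laurent_poly (h $ i $ j)" "laurent_vec x"
  shows "laurent_vec (h *v x)"
  using assms by (auto simp: laurent_vec_def matrix_vector_mult_def intro!: laurent_poly_sum laurent_poly_mult)

lemma laurent_inner_flip_transpose:
  assumes "\<And>i j. laurent_poly (h $ i $ j)" "laurent_vec y"
  shows "laurent_inner (flip_transpose h *v x) y = laurent_inner x (h *v y)"
proof -
  have "(\<Sum>j\<in>UNIV. (flip_transpose h *v x) $ j * flip_t (y $ j))
      = (\<Sum>j\<in>UNIV. \<Sum>i\<in>UNIV. x $ i * (flip_t (h $ i $ j) * flip_t (y $ j)))"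
    by (simp add: matrix_vector_mult_def sum_distrib_right sum_distrib_left mult_ac)
  also have "\<dots> = (\<Sum>i\<in>UNIV. \<Sum>j\<in>UNIV. x $ i * (flip_t (h $ i $ j) * flip_t (y $ j)))"
    by (rule sum.swap)
  also have "\<dots> = (\<Sum>i\<in>UNIV. x $ i * flip_t ((h *v y) $ i))"
    using assms
    by (simp add: matrix_vector_mult_def flip_t_sum laurent_poly_mult laurent_vec_def flip_t_mult
        sum_distrib_left)
  finally show ?thesis by (simp add: laurent_inner_def)
qed

section \<open>Orthonormal bases\<close>

locale onb =
  fixes V :: "'n::finite Fvec set" and m :: nat and v :: "nat \<Rightarrow> 'n Fvec"
  assumes basis: "orthonormal_basis V m v"
    and sub: "V \<subseteq> R_minus"
begin

lemma inj: "inj_on v {..<m}"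
  and indep: "rvs.independent (v ` {..<m})"
  and span: "rvs.span (v ` {..<m}) = V"
  and orthonormal: "\<And>i j. i < m \<Longrightarrow> j < m \<Longrightarrow> laurent_inner (v i) (v j) = (if i = j then 1 else 0)"
  using basis by (auto simp: orthonormal_basis_def real_basis_def)

lemma subspace: "rvs.subspace V"
  using rvs.subspace_span[of "v ` {..<m}"] by (simp add: span)

lemma basis_in: "i < m \<Longrightarrow> v i \<in> V"
  using rvs.span_base[of "v i" "v ` {..<m}"] by (simp add: span)

lemma lincomb_in: "lincomb m v a \<in> V"
  unfolding lincomb_def by (intro rvs.subspace_sum subspace rvs.subspace_scale basis_in) auto

lemma inner_lincomb: "i < m \<Longrightarrow> laurent_inner (lincomb m v a) (v i) = a i"
  unfolding lincomb_def
  by (simp add: laurent_inner_sum_left laurent_inner_rscale_left orthonormal if_distrib sum.delta cong: if_cong)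

lemma expand:
  assumes "x \<in> V"
  shows "lincomb m v (\<lambda>i. laurent_inner x (v i)) = x"
proof -
  obtain u where u: "x = (\<Sum>w\<in>v ` {..<m}. rscale (u w) w)"
    using assms unfolding span[symmetric] by (auto simp: rvs.span_finite)
  then have x: "x = lincomb m v (\<lambda>i. u (v i))"
    unfolding lincomb_def by (simp add: sum.reindex[OF inj])
  show ?thesis
    unfolding lincomb_def by (rule trans[OF _ x[unfolded lincomb_def, symmetric]])
      (rule sum.cong[OF refl], simp add: x inner_lincomb)
qed

lemma laurent_vec: "x \<in> V \<Longrightarrow> laurent_vec x"
  using sub R_minus_laurent_vec by auto

lemma nsq_lincomb: "nsq (lincomb m v a) = (\<Sum>i<m. (a i)\<^sup>2)"
proof -
  let ?x = "lincomb m v a"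
  have V: "?x \<in> V" by (rule lincomb_in)
  then have "nsq ?x = laurent_inner ?x ?x" using sub nsq_R_minus by auto
  also have "\<dots> = (\<Sum>i<m. a i * laurent_inner (v i) ?x)"
    by (subst (1) lincomb_def) (simp add: laurent_inner_sum_left laurent_inner_rscale_left)
  also have "\<dots> = (\<Sum>i<m. (a i)\<^sup>2)"
    by (intro sum.cong refl)
       (simp add: laurent_inner_commute[OF laurent_vec[OF basis_in] laurent_vec[OF V]] inner_lincomb power2_eq_square)
  finally show ?thesis .
qed

lemma nsq_expand: "x \<in> V \<Longrightarrow> nsq x = (\<Sum>i<m. (laurent_inner x (v i))\<^sup>2)"
  using nsq_lincomb[of "\<lambda>i. laurent_inner x (v i)"] by (simp add: expand)

lemma basis_support:
  obtains S where "finite S" "\<And>i j k. i < m \<Longrightarrow> k \<notin> S \<Longrightarrow> v i $ j $$ k = 0"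
proof -
  have "\<forall>i. i < m \<longrightarrow> (\<exists>S. finite S \<and> (\<forall>j k. k \<notin> S \<longrightarrow> v i $ j $$ k = 0))"
    using laurent_vec_support[OF laurent_vec[OF basis_in]] by metis
  then obtain S where S: "\<And>i. i < m \<Longrightarrow> finite (S i) \<and> (\<forall>j k. k \<notin> S i \<longrightarrow> v i $ j $$ k = 0)"
    by metis
  show ?thesis by (rule that[of "\<Union>i<m. S i"]) (use S in auto)
qed

text \<open>All orthonormal coordinates are linear combinations of the same finitely many coefficients; hence they
  are continuous and measurable for the structures that the coefficients induce on \<open>V\<close>.\<close>

lemma inner_coords:
  obtains S where "finite S"
    "\<And>i x. i < m \<Longrightarrow> laurent_inner x (v i) = (\<Sum>j\<in>UNIV. \<Sum>k\<in>S. x $ j $$ k * v i $ j $$ k)"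
proof -
  obtain S where S: "finite S" "\<And>i j k. i < m \<Longrightarrow> k \<notin> S \<Longrightarrow> v i $ j $$ k = 0"
    using basis_support by blast
  show ?thesis by (rule that[OF S(1)], rule laurent_inner_nth[OF S]) 
qed

lemma lincomb_nth: "lincomb m v a $ j $$ k = (\<Sum>i<m. a i * v i $ j $$ k)"
  unfolding lincomb_def Fvec_sum_nth by simp

lemma lincomb_add: "lincomb m v a + lincomb m v b = lincomb m v (\<lambda>i. a i + b i)"
  by (rule Fvec_eqI) (simp add: lincomb_nth algebra_simps sum.distrib)

lemma lincomb_cong: "(\<And>i. i < m \<Longrightarrow> a i = b i) \<Longrightarrow> lincomb m v a = lincomb m v b"
  unfolding lincomb_def by (intro sum.cong refl) auto

lemma dim_eq: "rvs.dim V = m"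
  using rvs.dim_eq_card[OF _ indep, of V] span card_image[OF inj] by (simp add: rvs.span_eq_iff[THEN iffD2, OF subspace])

end

lemma orthonormal_inj_independent:
  fixes v :: "nat \<Rightarrow> 'n::finite Fvec"
  assumes "\<And>i j. i < m \<Longrightarrow> j < m \<Longrightarrow> laurent_inner (v i) (v j) = (if i = j then 1 else 0)"
  shows "inj_on v {..<m}" "rvs.independent (v ` {..<m})"
proof -
  show inj: "inj_on v {..<m}"
  proof (rule inj_onI)
    fix i j assume "i \<in> {..<m}" "j \<in> {..<m}" "v i = v j"
    then show "i = j" using assms[of i j] assms[of i i] by (auto split: if_splits)
  qed
  show "rvs.independent (v ` {..<m})"
  proof (rule rvs.independent_if_scalars_zero)
    fix f x assume "(\<Sum>x\<in>v ` {..<m}. rscale (f x) x) = 0" "x \<in> v ` {..<m}"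
    then obtain i where i: "i < m" "x = v i" by auto
    have "0 = laurent_inner (\<Sum>x\<in>v ` {..<m}. rscale (f x) x) (v i)"
      using \<open>_ = 0\<close> by simp
    also have "\<dots> = (\<Sum>j<m. f (v j) * laurent_inner (v j) (v i))"
      by (simp add: sum.reindex[OF inj] laurent_inner_sum_left laurent_inner_rscale_left)
    also have "\<dots> = f x"
      using i by (simp add: assms if_distrib sum.delta cong: if_cong)
    finally show "f x = 0" by simp
  qed simp
qed

lemma gram_schmidt:
  fixes B :: "'n::finite Fvec set"
  assumes "finite B" "rvs.independent B" "B \<subseteq> R_minus"
  shows "\<exists>m v. orthonormal_basis (rvs.span B) m v"
  using assms
proof (induction B rule: finite_induct)
  case empty
  have "orthonormal_basis (rvs.span {}) 0 (\<lambda>i. 0 :: 'n Fvec)"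
    by (simp add: orthonormal_basis_def real_basis_def rvs.independent_empty)
  then show ?case by blast
next
  case (insert b B)
  then have b: "b \<notin> rvs.span B" "rvs.independent B" "b \<in> R_minus" "B \<subseteq> R_minus"
    using rvs.independent_insert[of b B] by auto
  then obtain m v where ob: "orthonormal_basis (rvs.span B) m v" using insert.IH by blast
  have sub: "rvs.span B \<subseteq> R_minus" by (rule rvs.span_minimal[OF b(4) R_minus_subspace])
  interpret onb "rvs.span B" m v by unfold_locales (use ob sub in auto)
  define p where "p = lincomb m v (\<lambda>i. laurent_inner b (v i))"
  define u where "u = b - p"
  \<comment> \<open>The part of \<open>b\<close> orthogonal to the span of \<open>B\<close>, normalised.\<close>
  define w where "w = rscale (1 / sqrt (nsq u)) u"
  have p: "p \<in> rvs.span B" unfolding p_def by (rule lincomb_in)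
  have u: "u \<in> R_minus" "u \<noteq> 0"
    using p b sub by (auto simp: u_def R_minus_diff)
  then have pos: "nsq u > 0" using nsq_eq_0 nsq_nonneg by (metis less_eq_real_def)
  have w: "w \<in> R_minus" using u by (simp add: w_def R_minus_rscale)
  have uv: "laurent_inner u (v i) = 0" if "i < m" for i
    using that by (simp add: u_def p_def laurent_inner_diff_left inner_lincomb)
  then have wv: "laurent_inner w (v i) = 0" if "i < m" for i
    using that by (simp add: w_def laurent_inner_rscale_left)
  then have vw: "laurent_inner (v i) w = 0" if "i < m" for i
    using that laurent_inner_commute[OF laurent_vec[OF basis_in] R_minus_laurent_vec[OF w]] by simp
  have ww: "laurent_inner w w = 1"
    using pos by (simp add: w_def laurent_inner_rscale_left laurent_inner_rscale_right
        R_minus_laurent_vec u nsq_R_minus[symmetric] field_simps)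
  define v' where "v' = v(m := w)"
  have on: "laurent_inner (v' i) (v' j) = (if i = j then 1 else 0)" if "i < Suc m" "j < Suc m" for i j
    using that by (auto simp: v'_def orthonormal wv vw ww less_Suc_eq)
  have img: "v' ` {..<Suc m} = insert w (v ` {..<m})"
    by (auto simp: v'_def image_iff less_Suc_eq)
  have "rvs.span (insert w (v ` {..<m})) = rvs.span (insert u (v ` {..<m}))"
  proof (subst rvs.span_eq, intro conjI)
    let ?S = "v ` {..<m}"
    have "w \<in> rvs.span (insert u ?S)"
      unfolding w_def by (intro rvs.span_scale rvs.span_base) auto
    then show "insert w ?S \<subseteq> rvs.span (insert u ?S)"
      using rvs.span_superset[of "insert u ?S"] by auto
    have "u = rscale (sqrt (nsq u)) w"
      using pos by (simp add: w_def)
    then have "u \<in> rvs.span (insert w ?S)"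
      by (metis insertI1 rvs.span_scale rvs.span_base)
    then show "insert u ?S \<subseteq> rvs.span (insert w ?S)"
      using rvs.span_superset[of "insert w ?S"] by auto
  qed
  also have "\<dots> = rvs.span (insert b (v ` {..<m}))"
    by (rule rvs.eq_span_insert_eq[symmetric]) (use p in \<open>simp add: u_def span\<close>)
  also have "\<dots> = rvs.span (insert b B)"
    unfolding rvs.span_insert span ..
  finally have "orthonormal_basis (rvs.span (insert b B)) (Suc m) v'"
    unfolding orthonormal_basis_def real_basis_def
    using orthonormal_inj_independent[of "Suc m" v'] on img by auto
  then show ?case by blast
qed

text \<open>Gram-Schmidt keeps the number of vectors, as both families are bases of \<open>V\<close>.\<close>

lemma real_basis_orthonormal:
  fixes V :: "'n::finite Fvec set"
  assumes "real_basis V m v" "V \<subseteq> R_minus"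
  obtains w where "orthonormal_basis V m w"
proof -
  have "v ` {..<m} \<subseteq> R_minus"
    using assms rvs.span_superset[of "v ` {..<m}"] by (auto simp: real_basis_def)
  then obtain k w where kw: "orthonormal_basis V k w"
    using gram_schmidt[of "v ` {..<m}"] assms by (auto simp: real_basis_def)
  interpret onb V k w by unfold_locales (use kw assms in auto)
  have "rvs.dim V = m"
    using rvs.dim_eq_card[of "v ` {..<m}" V] assms(1) subspace
    by (simp add: real_basis_def card_image rvs.span_eq_iff[THEN iffD2])
  then show ?thesis using that[of w] kw dim_eq by simp
qed

section \<open>The Borel sets of a space of principal parts\<close>

text \<open>Carries the measurable sets that the definition of a Haar measure prescribes.\<close>

definition vsig :: "'n::finite Fvec set \<Rightarrow> 'n Fvec measure" where
  "vsig V = sigma V {U. openin (vtop V) U}"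

definition coords :: "'n::finite Fvec \<Rightarrow> 'n \<times> int \<Rightarrow> real" where
  "coords x = (\<lambda>(j, k). x $ j $$ k)"

lemma vtop_eq: "vtop V = pullback_topology V coords euclidean"
  unfolding vtop_def coords_def ..

lemma openin_vtop: "openin (vtop V) S \<longleftrightarrow> (\<exists>U. open U \<and> S = coords -` U \<inter> V)"
  by (simp add: vtop_eq openin_pullback_topology)

lemma topspace_vtop [simp]: "topspace (vtop V) = V"
  by (auto simp: vtop_eq topspace_pullback_topology)

lemma vsig_eq: "vsig V = vimage_algebra V coords borel"
proof -
  have "vimage_algebra V coords (sigma UNIV {S. open S}) =
      sigma V {coords -` A \<inter> V | A. A \<in> {S. open S}}"
    by (rule vimage_algebra_sigma) auto
  moreover have "{coords -` A \<inter> V | A. A \<in> {S. open S}} = {U. openin (vtop V) U}"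
    by (auto simp: openin_vtop)
  ultimately show ?thesis by (simp add: vsig_def borel_def)
qed

lemma space_vsig [simp]: "space (vsig V) = V"
  by (simp add: vsig_eq)

lemma openin_vtop_Pow: "{U. openin (vtop V) U} \<subseteq> Pow V"
  using openin_subset[of "vtop V"] by auto

lemma sets_vsig: "sets (vsig V) = sigma_sets V {U. openin (vtop V) U}"
  unfolding vsig_def using openin_vtop_Pow by (rule sets_measure_of)

text \<open>There are countably many coefficients, so the Borel sets of their product topology are generated by
  the single coefficients.\<close>

lemma measurable_vsigI:
  assumes "\<And>\<omega>. \<omega> \<in> space M \<Longrightarrow> f \<omega> \<in> V"
    and "\<And>j k. (\<lambda>\<omega>. f \<omega> $ j $$ k) \<in> borel_measurable M"
  shows "f \<in> measurable M (vsig V)"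
  unfolding vsig_eq
proof (rule measurable_vimage_algebra2)
  show "(\<lambda>\<omega>. coords (f \<omega>)) \<in> borel_measurable M"
    by (rule measurable_coordinatewise_then_product) (auto simp: coords_def assms(2) split: prod.split)
qed (use assms in auto)

lemma measurable_nth [measurable]: "(\<lambda>x. x $ j $$ k) \<in> borel_measurable (vsig V)"
proof -
  have "coords \<in> measurable (vsig V) borel"
    unfolding vsig_eq by (rule measurable_vimage_algebra1) auto
  then have "(\<lambda>x. coords x (j, k)) \<in> borel_measurable (vsig V)"
    by (rule measurable_compose[OF _ measurable_product_coordinates])
  then show ?thesis by (simp add: coords_def)
qed

lemma measurable_nth' [measurable (raw)]:
  "f \<in> measurable M (vsig V) \<Longrightarrow> (\<lambda>\<omega>. f \<omega> $ j $$ k) \<in> borel_measurable M"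
  by (rule measurable_compose[OF _ measurable_nth])

lemma haar_space: "haar_measure V \<mu> \<Longrightarrow> space \<mu> = V"
  and haar_sets: "haar_measure V \<mu> \<Longrightarrow> sets \<mu> = sets (vsig V)"
  and haar_translate: "haar_measure V \<mu> \<Longrightarrow> x \<in> V \<Longrightarrow> A \<in> sets (vsig V) \<Longrightarrow>
    emeasure \<mu> ((+) x ` A) = emeasure \<mu> A"
  by (auto simp: haar_measure_def sets_vsig)

lemma nsq_measurable:
  assumes "\<And>j k. (\<lambda>\<omega>. f \<omega> $ j $$ k) \<in> borel_measurable M"
  shows "(\<lambda>\<omega>. nsq (f \<omega>)) \<in> borel_measurable M"
  unfolding nsq_def using assms by measurable

section \<open>Translation-invariant measures\<close>

lemma add_measurable:
  assumes "rvs.subspace V"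
  shows "(\<lambda>(x, y). x + y) \<in> measurable (vsig V \<Otimes>\<^sub>M vsig V) (vsig V)"
proof (rule measurable_vsigI)
  fix \<omega> :: "'a Fvec \<times> 'a Fvec" assume "\<omega> \<in> space (vsig V \<Otimes>\<^sub>M vsig V)"
  then show "(case \<omega> of (x, y) \<Rightarrow> x + y) \<in> V"
    using rvs.subspace_add[OF assms] by (auto simp: space_pair_measure)
next
  fix j k
  have "(\<lambda>\<omega>. fst \<omega> $ j $$ k + snd \<omega> $ j $$ k) \<in> borel_measurable (vsig V \<Otimes>\<^sub>M vsig V)"
    by measurable
  then show "(\<lambda>\<omega>. (case \<omega> of (x, y) \<Rightarrow> x + y) $ j $$ k) \<in> borel_measurable (vsig V \<Otimes>\<^sub>M vsig V)"
    by (simp add: split_beta)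
qed

lemma uminus_measurable:
  assumes "rvs.subspace V"
  shows "uminus \<in> measurable (vsig V) (vsig V)"
  by (rule measurable_vsigI) (auto simp: rvs.subspace_neg[OF assms])

lemma haar_distr:
  assumes V: "rvs.subspace V" and mu: "haar_measure V \<mu>" and x: "x \<in> V"
  shows "distr \<mu> (vsig V) ((+) x) = \<mu>"
proof (rule measure_eqI)
  show "sets (distr \<mu> (vsig V) ((+) x)) = sets \<mu>" by (simp add: haar_sets[OF mu])
  fix A assume "A \<in> sets (distr \<mu> (vsig V) ((+) x))"
  then have A: "A \<in> sets (vsig V)" by simp
  have AV: "A \<subseteq> V" using sets.sets_into_space[OF A] by simp
  have meas: "(+) x \<in> measurable \<mu> (vsig V)"
    by (rule measurable_vsigI)
       (auto simp: haar_space[OF mu] rvs.subspace_add[OF V x] measurable_cong_sets[OF haar_sets[OF mu] refl])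
  have "(+) x -` A \<inter> V = (+) (- x) ` A"
  proof safe
    fix y assume "x + y \<in> A" then show "y \<in> (+) (- x) ` A"
      by (intro image_eqI[of _ _ "x + y"]) auto
  next
    fix y assume "y \<in> A"
    then show "- x + y \<in> V" using AV rvs.subspace_add[OF V rvs.subspace_neg[OF V x]] by auto
  qed auto
  then show "emeasure (distr \<mu> (vsig V) ((+) x)) A = emeasure \<mu> A"
    using A meas haar_translate[OF mu rvs.subspace_neg[OF V x] A] by (simp add: emeasure_distr haar_space[OF mu])
qed

lemma haar_nn_integral_translate:
  assumes V: "rvs.subspace V" and mu: "haar_measure V \<mu>" and x: "x \<in> V"
    and f: "f \<in> borel_measurable (vsig V)"
  shows "(\<integral>\<^sup>+y. f (x + y) \<partial>\<mu>) = (\<integral>\<^sup>+y. f y \<partial>\<mu>)"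
proof -
  have meas: "(+) x \<in> measurable \<mu> (vsig V)"
    by (rule measurable_vsigI)
       (auto simp: haar_space[OF mu] rvs.subspace_add[OF V x] measurable_cong_sets[OF haar_sets[OF mu] refl])
  have "(\<integral>\<^sup>+y. f y \<partial>\<mu>) = (\<integral>\<^sup>+y. f y \<partial>distr \<mu> (vsig V) ((+) x))"
    by (simp add: haar_distr[OF V mu x])
  also have "\<dots> = (\<integral>\<^sup>+y. f (x + y) \<partial>\<mu>)"
    by (rule nn_integral_distr[OF meas]) (use f in simp)
  finally show ?thesis ..
qed

text \<open>Both sides compute the double integral of \<open>1\<^sub>A(x) 1\<^sub>B(x + y)\<close>: invariance of \<open>\<nu>\<close> under \<open>y \<mapsto> x + y\<close> gives
  the left-hand side.  For the right-hand side, Fubini and invariance of \<open>\<mu>\<close> under \<open>x \<mapsto> x - y\<close> turn the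
  integrand into \<open>1\<^sub>A(x - y) 1\<^sub>B(x)\<close>, and the integral over \<open>y\<close> is then the measure of the reflection of \<open>A\<close>.\<close>

lemma haar_swap:
  assumes V: "rvs.subspace V" and mu: "haar_measure V \<mu>" and nu: "haar_measure V \<nu>"
    and fin: "sigma_finite_measure \<mu>" "sigma_finite_measure \<nu>"
    and A: "A \<in> sets (vsig V)" and B: "B \<in> sets (vsig V)"
  shows "emeasure \<mu> A * emeasure \<nu> B = emeasure \<nu> (uminus -` A \<inter> V) * emeasure \<mu> B"
proof -
  interpret mu: sigma_finite_measure \<mu> by fact
  interpret nu: sigma_finite_measure \<nu> by fact
  interpret mn: pair_sigma_finite \<mu> \<nu> ..
  note [measurable_cong] = haar_sets[OF mu] haar_sets[OF nu]
  note [measurable] = A B uminus_measurable[OF V]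
  have add [measurable]: "(\<lambda>\<omega>. f \<omega> + g \<omega>) \<in> measurable M (vsig V)"
    if "f \<in> measurable M (vsig V)" "g \<in> measurable M (vsig V)" for f g and M :: "'b measure"
    using measurable_compose[OF measurable_Pair[OF that] add_measurable[OF V]] by simp
  have [measurable]: "(\<lambda>\<omega>. - f \<omega>) \<in> measurable M (vsig V)"
    if "f \<in> measurable M (vsig V)" for f and M :: "'b measure"
    using measurable_compose[OF that uminus_measurable[OF V]] .
  have nV: "- x \<in> V" if "x \<in> V" for x using rvs.subspace_neg[OF V that] .
  have "emeasure \<mu> A * emeasure \<nu> B = (\<integral>\<^sup>+x. indicator A x * emeasure \<nu> B \<partial>\<mu>)"
    by (simp add: nn_integral_multc haar_sets[OF mu])
  also have "\<dots> = (\<integral>\<^sup>+x. indicator A x * (\<integral>\<^sup>+y. indicator B (x + y) \<partial>\<nu>) \<partial>\<mu>)"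
  proof (rule nn_integral_cong)
    fix x assume "x \<in> space \<mu>"
    then have "(\<integral>\<^sup>+y. indicator B (x + y) \<partial>\<nu>) = (\<integral>\<^sup>+y. indicator B y \<partial>\<nu>)"
      by (intro haar_nn_integral_translate[OF V nu]) (auto simp: haar_space[OF mu])
    then show "indicator A x * emeasure \<nu> B = indicator A x * (\<integral>\<^sup>+y. indicator B (x + y) \<partial>\<nu>)"
      by (simp add: haar_sets[OF nu])
  qed
  also have "\<dots> = (\<integral>\<^sup>+x. (\<integral>\<^sup>+y. indicator A x * indicator B (x + y) \<partial>\<nu>) \<partial>\<mu>)"
  proof (rule nn_integral_cong)
    fix x assume x: "x \<in> space \<mu>"
    have "(\<lambda>y. indicator B (x + y)::ennreal) \<in> borel_measurable \<nu>"
    proof -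
      have "(+) x \<in> measurable \<nu> (vsig V)"
        using x by (intro add measurable_const) (auto simp: haar_space[OF mu])
      then show ?thesis by measurable
    qed
    then show "indicator A x * (\<integral>\<^sup>+y. indicator B (x + y) \<partial>\<nu>) = (\<integral>\<^sup>+y. indicator A x * indicator B (x + y) \<partial>\<nu>)"
      by (simp add: nn_integral_cmult)
  qed
  also have "\<dots> = (\<integral>\<^sup>+y. (\<integral>\<^sup>+x. indicator A x * indicator B (x + y) \<partial>\<mu>) \<partial>\<nu>)"
    by (rule mn.Fubini'[symmetric]) measurable
  also have "\<dots> = (\<integral>\<^sup>+y. (\<integral>\<^sup>+x. indicator A (- y + x) * indicator B x \<partial>\<mu>) \<partial>\<nu>)"
  proof (rule nn_integral_cong)
    fix y assume "y \<in> space \<nu>"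
    then have y: "y \<in> V" by (simp add: haar_space[OF nu])
    have [measurable]: "(+) y \<in> measurable (vsig V) (vsig V)" "(+) (- y) \<in> measurable (vsig V) (vsig V)"
      "(\<lambda>x. x + y) \<in> measurable (vsig V) (vsig V)"
      using y nV[OF y] by (intro add measurable_const; simp)+
    have "(\<integral>\<^sup>+x. indicator A x * indicator B (x + y) \<partial>\<mu>) =
        (\<integral>\<^sup>+x. indicator A (- y + x) * indicator B ((- y + x) + y) \<partial>\<mu> :: ennreal)"
      by (rule haar_nn_integral_translate[OF V mu nV[OF y], symmetric]) measurable
    then show "(\<integral>\<^sup>+x. indicator A x * indicator B (x + y) \<partial>\<mu>) =
        (\<integral>\<^sup>+x. indicator A (- y + x) * indicator B x \<partial>\<mu> :: ennreal)"
      by simp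
  qed
  also have "\<dots> = (\<integral>\<^sup>+x. (\<integral>\<^sup>+y. indicator A (- y + x) * indicator B x \<partial>\<nu>) \<partial>\<mu>)"
    by (rule mn.Fubini') measurable
  also have "\<dots> = (\<integral>\<^sup>+x. emeasure \<nu> (uminus -` A \<inter> V) * indicator B x \<partial>\<mu>)"
  proof (rule nn_integral_cong)
    fix x assume "x \<in> space \<mu>"
    then have x: "x \<in> V" by (simp add: haar_space[OF mu])
    have [measurable]: "(\<lambda>y. - y + x) \<in> measurable (vsig V) (vsig V)"
      using x uminus_measurable[OF V] by (intro add measurable_const) auto
    have "(\<integral>\<^sup>+y. indicator A (- y + x) * indicator B x \<partial>\<nu>) = (\<integral>\<^sup>+y. indicator A (- y + x) \<partial>\<nu>) * indicator B x"
      by (rule nn_integral_multc) measurable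
    also have "(\<integral>\<^sup>+y. indicator A (- y + x) \<partial>\<nu>) = (\<integral>\<^sup>+y. indicator A (- (x + y) + x) \<partial>\<nu> :: ennreal)"
      by (rule haar_nn_integral_translate[OF V nu x, symmetric]) measurable
    also have "\<dots> = (\<integral>\<^sup>+y. indicator (uminus -` A \<inter> V) y \<partial>\<nu>)"
      by (rule nn_integral_cong) (auto simp: haar_space[OF nu] indicator_def)
    also have "\<dots> = emeasure \<nu> (uminus -` A \<inter> V)"
      using measurable_sets[OF uminus_measurable[OF V] A] by (simp add: haar_sets[OF nu])
    finally show "(\<integral>\<^sup>+y. indicator A (- y + x) * indicator B x \<partial>\<nu>) = emeasure \<nu> (uminus -` A \<inter> V) * indicator B x" .
  qed
  also have "\<dots> = emeasure \<nu> (uminus -` A \<inter> V) * emeasure \<mu> B"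
    by (simp add: nn_integral_cmult haar_sets[OF mu])
  finally show ?thesis .
qed

text \<open>With \<open>\<mu> = \<nu>\<close> the previous lemma says that \<open>\<nu>\<close> is invariant under reflection; then it says that \<open>\<mu>\<close> and
  \<open>\<nu>\<close> are proportional.\<close>

lemma haar_unique:
  assumes V: "rvs.subspace V" and mu: "haar_measure V \<mu>" and nu: "haar_measure V \<nu>"
    and fin: "sigma_finite_measure \<mu>" "sigma_finite_measure \<nu>"
    and B: "B \<in> sets (vsig V)" "emeasure \<nu> B = 1"
    and A: "A \<in> sets (vsig V)"
  shows "emeasure \<mu> A = emeasure \<mu> B * emeasure \<nu> A"
  using haar_swap[OF V mu nu fin A B(1)] haar_swap[OF V nu nu fin(2) fin(2) A B(1)] B(2)
  by (simp add: mult.commute)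

section \<open>The Haar measure of an inner product\<close>

interpretation lborel_product: product_sigma_finite "\<lambda>i :: nat. lborel :: real measure" ..

lemma PiM_lborel_translate:
  assumes "finite (I :: nat set)"
  shows "distr (Pi\<^sub>M I (\<lambda>_. lborel)) (Pi\<^sub>M I (\<lambda>_. lborel)) (\<lambda>a. \<lambda>i\<in>I. b i + a i) =
    Pi\<^sub>M I (\<lambda>_. lborel :: real measure)" (is "distr ?L _ ?T = _")
proof (rule lborel_product.PiM_eqI[OF assms])
  fix A :: "nat \<Rightarrow> real set" assume A: "\<And>i. i \<in> I \<Longrightarrow> A i \<in> sets lborel"
  then have [measurable]: "\<And>i. i \<in> I \<Longrightarrow> A i \<in> sets borel" by simp
  have T: "?T \<in> measurable ?L ?L"
    by (rule measurable_restrict) measurable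
  have pre: "?T -` Pi\<^sub>E I A \<inter> space ?L = Pi\<^sub>E I (\<lambda>i. (+) (b i) -` A i)"
    by (auto simp: space_PiM PiE_iff extensional_def)
  have "emeasure (distr ?L ?L ?T) (Pi\<^sub>E I A) = emeasure ?L (Pi\<^sub>E I (\<lambda>i. (+) (b i) -` A i))"
    using A assms by (subst emeasure_distr[OF T]) (auto simp: pre sets_PiM_I_finite)
  also have "\<dots> = (\<Prod>i\<in>I. emeasure lborel ((+) (b i) -` A i))"
    using A assms by (intro lborel_product.emeasure_PiM) (auto intro!: measurable_sets_borel[of "(+) (b _)" borel])
  also have "\<dots> = (\<Prod>i\<in>I. emeasure lborel (A i))"
  proof (rule prod.cong[OF refl])
    fix i assume "i \<in> I"
    then have "emeasure (distr lborel borel ((+) (b i))) (A i) = emeasure lborel ((+) (b i) -` A i)"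
      using A by (subst emeasure_distr) auto
    then show "emeasure lborel ((+) (b i) -` A i) = emeasure lborel (A i)"
      by (simp add: lborel_distr_plus)
  qed
  finally show "emeasure (distr ?L ?L ?T) (Pi\<^sub>E I A) = (\<Prod>i\<in>I. emeasure lborel (A i))" .
qed simp

lemma nn_integral_gaussian:
  assumes "c > 0"
  shows "(\<integral>\<^sup>+x. ennreal (exp (- pi * c * x\<^sup>2)) \<partial>lborel) = ennreal (c powr (- 1 / 2))"
proof -
  \<comment> \<open>The deviation for which the normal density is a multiple of \<open>exp (- pi * c * x\<^sup>2)\<close>.\<close>
  define \<sigma> where "\<sigma> = 1 / sqrt (2 * pi * c)"
  have \<sigma>: "\<sigma> > 0" "2 * pi * \<sigma>\<^sup>2 = 1 / c" "2 * \<sigma>\<^sup>2 = 1 / (pi * c)"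
    using assms by (auto simp: \<sigma>_def power_divide real_sqrt_pow2)
  have nd: "normal_density 0 \<sigma> x = sqrt c * exp (- pi * c * x\<^sup>2)" for x
    unfolding normal_density_def \<sigma>(2,3) using assms by (simp add: real_sqrt_divide mult_ac)
  have "1 = (\<integral>\<^sup>+x. ennreal (normal_density 0 \<sigma> x) \<partial>lborel)"
    using \<sigma> by (subst nn_integral_eq_integral) auto
  also have "\<dots> = (\<integral>\<^sup>+x. ennreal (sqrt c) * ennreal (exp (- pi * c * x\<^sup>2)) \<partial>lborel)"
    unfolding nd using assms by (intro nn_integral_cong ennreal_mult) auto
  also have "\<dots> = ennreal (sqrt c) * (\<integral>\<^sup>+x. ennreal (exp (- pi * c * x\<^sup>2)) \<partial>lborel)"
    by (rule nn_integral_cmult) measurable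
  finally have 1: "1 = ennreal (sqrt c) * (\<integral>\<^sup>+x. ennreal (exp (- pi * c * x\<^sup>2)) \<partial>lborel)" .
  have c: "c powr (- 1 / 2) * sqrt c = 1"
    using assms by (simp add: powr_minus powr_half_sqrt field_simps)
  have "ennreal (c powr (- 1 / 2)) = ennreal (c powr (- 1 / 2)) * (ennreal (sqrt c) * (\<integral>\<^sup>+x. ennreal (exp (- pi * c * x\<^sup>2)) \<partial>lborel))"
    using 1 by simp
  also have "\<dots> = (ennreal (c powr (- 1 / 2)) * ennreal (sqrt c)) * (\<integral>\<^sup>+x. ennreal (exp (- pi * c * x\<^sup>2)) \<partial>lborel)"
    by (simp only: mult.assoc)
  also have "ennreal (c powr (- 1 / 2)) * ennreal (sqrt c) = 1"
    using c assms by (simp flip: ennreal_mult)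
  finally show ?thesis by simp
qed

definition gauss :: "real \<Rightarrow> 'n::finite Fvec \<Rightarrow> real" where
  "gauss c x = exp (- pi * c * nsq x)"

lemma gaussian_eq: "gaussian c x = complex_of_real (gauss c x)"
  by (simp add: gaussian_def gauss_def nsq_def)

lemma gauss_pos: "gauss c x > 0"
  by (simp add: gauss_def)

lemma gauss_measurable:
  assumes "\<And>j k. (\<lambda>\<omega>. f \<omega> $ j $$ k) \<in> borel_measurable M"
  shows "(\<lambda>\<omega>. gauss c (f \<omega>)) \<in> borel_measurable M"
  unfolding gauss_def using nsq_measurable[OF assms] by measurable

context onb
begin

definition leb :: "'n Fvec measure" where
  "leb = distr (Pi\<^sub>M {..<m} (\<lambda>_. lborel)) (vsig V) (lincomb m v)"

lemma lincomb_measurable: "lincomb m v \<in> measurable (Pi\<^sub>M {..<m} (\<lambda>_. lborel)) (vsig V)"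
proof (rule measurable_vsigI)
  fix j k
  have "(\<lambda>a. \<Sum>i<m. a i * v i $ j $$ k) \<in> borel_measurable (Pi\<^sub>M {..<m} (\<lambda>_. lborel :: real measure))"
    by measurable
  then show "(\<lambda>a. lincomb m v a $ j $$ k) \<in> borel_measurable (Pi\<^sub>M {..<m} (\<lambda>_. lborel))"
    by (simp add: lincomb_nth)
qed (rule lincomb_in)

lemma inner_measurable: "i < m \<Longrightarrow> (\<lambda>x. laurent_inner x (v i)) \<in> borel_measurable (vsig V)"
proof -
  assume i: "i < m"
  obtain S where S: "finite S"
    "\<And>i x. i < m \<Longrightarrow> laurent_inner x (v i) = (\<Sum>j\<in>UNIV. \<Sum>k\<in>S. x $ j $$ k * v i $ j $$ k)"
    using inner_coords by blast
  show ?thesis by (simp add: S(2)[OF i])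
qed

lemma coord_continuous: "continuous_map (vtop V) euclideanreal (\<lambda>x. x $ j $$ k)"
proof -
  have "continuous_map euclidean euclideanreal (\<lambda>u :: 'n \<times> int \<Rightarrow> real. u (j, k))"
    by (simp add: continuous_on_product_coordinates)
  then have "continuous_map (vtop V) euclideanreal ((\<lambda>u. u (j, k)) \<circ> coords)"
    unfolding vtop_eq by (rule continuous_map_pullback)
  then show ?thesis by (simp add: o_def coords_def)
qed

lemma inner_continuous: "i < m \<Longrightarrow> continuous_map (vtop V) euclideanreal (\<lambda>x. laurent_inner x (v i))"
proof -
  assume i: "i < m"
  obtain S where S: "finite S"
    "\<And>i x. i < m \<Longrightarrow> laurent_inner x (v i) = (\<Sum>j\<in>UNIV. \<Sum>k\<in>S. x $ j $$ k * v i $ j $$ k)"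
    using inner_coords by blast
  show ?thesis unfolding S(2)[OF i]
    by (intro continuous_intros S(1) coord_continuous) auto
qed

definition coord_box :: "real \<Rightarrow> real \<Rightarrow> 'n Fvec set" where
  "coord_box l u = {x \<in> V. \<forall>i<m. l \<le> laurent_inner x (v i) \<and> laurent_inner x (v i) \<le> u}"

lemma coord_box_eq: "coord_box l u = {lincomb m v a | a. \<forall>i<m. l \<le> a i \<and> a i \<le> u}"
proof safe
  fix x assume "x \<in> coord_box l u"
  then show "\<exists>a. x = lincomb m v a \<and> (\<forall>i<m. l \<le> a i \<and> a i \<le> u)"
    by (intro exI[of _ "\<lambda>i. laurent_inner x (v i)"]) (auto simp: coord_box_def expand)
qed (auto simp: coord_box_def lincomb_in inner_lincomb)

lemma coord_box_sets: "coord_box l u \<in> sets (vsig V)"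
proof -
  have "{x \<in> space (vsig V). l \<le> laurent_inner x (v i) \<and> laurent_inner x (v i) \<le> u} \<in> sets (vsig V)"
    if "i \<in> {..<m}" for i
  proof -
    have [measurable]: "(\<lambda>x. laurent_inner x (v i)) \<in> borel_measurable (vsig V)"
      using inner_measurable that by simp
    show ?thesis by measurable
  qed
  then have "{x \<in> space (vsig V). \<forall>i\<in>{..<m}. l \<le> laurent_inner x (v i) \<and> laurent_inner x (v i) \<le> u} \<in> sets (vsig V)"
    by (rule sets.sets_Collect_finite_All) auto
  moreover have "{x \<in> space (vsig V). \<forall>i\<in>{..<m}. l \<le> laurent_inner x (v i) \<and> laurent_inner x (v i) \<le> u} = coord_box l u"
    by (auto simp: coord_box_def)
  ultimately show ?thesis by simp
qed

text \<open>The boxes are compact and exhaust \<open>V\<close>, so Haar measures are finite on them and \<open>\<sigma>\<close>-finite.\<close>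

lemma coord_box_compact:
  assumes "l \<le> u"
  shows "compactin (vtop V) (coord_box l u)"
proof -
  let ?B = "PiE UNIV (\<lambda>i. {l..u}) :: (nat \<Rightarrow> real) set"
  have "compactin (product_topology (\<lambda>i. euclidean) UNIV) ?B"
    by (subst compactin_PiE) auto
  then have B: "compactin (euclidean :: (nat \<Rightarrow> real) topology) ?B"
    by (simp add: euclidean_product_topology)
  have "continuous_map euclidean (vtop V) (lincomb m v)"
    unfolding vtop_eq
  proof (rule continuous_map_pullback')
    have "continuous_on UNIV (\<lambda>a. coords (lincomb m v a))"
    proof (rule continuous_on_coordinatewise_then_product)
      fix i :: "'n \<times> int"
      have "continuous_on UNIV (\<lambda>a. \<Sum>l<m. a l * v l $ fst i $$ snd i)"
        by (intro continuous_intros continuous_on_product_coordinates)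
      then show "continuous_on UNIV (\<lambda>a. coords (lincomb m v a) i)"
        by (simp add: coords_def lincomb_nth split_beta)
    qed
    then show "continuous_map euclidean euclidean (coords \<circ> lincomb m v)"
      by (simp add: o_def)
  qed (auto simp: lincomb_in)
  then have "compactin (vtop V) (lincomb m v ` ?B)"
    by (rule image_compactin[OF B])
  moreover have "lincomb m v ` ?B = coord_box l u"
    unfolding coord_box_eq
  proof safe
    fix a :: "nat \<Rightarrow> real" assume a: "\<forall>i<m. l \<le> a i \<and> a i \<le> u"
    show "lincomb m v a \<in> lincomb m v ` ?B"
    proof (rule image_eqI)
      show "lincomb m v a = lincomb m v (\<lambda>i. if i < m then a i else l)"
        by (rule lincomb_cong) simp
      show "(\<lambda>i. if i < m then a i else l) \<in> ?B"
        using a assms by (auto simp: PiE_UNIV_domain)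
    qed
  next
    fix a :: "nat \<Rightarrow> real" assume a: "a \<in> ?B"
    then have "\<forall>i<m. l \<le> a i \<and> a i \<le> u" by (simp add: PiE_iff)
    then show "\<exists>b. lincomb m v a = lincomb m v b \<and> (\<forall>i<m. l \<le> b i \<and> b i \<le> u)" by blast
  qed
  ultimately show ?thesis by simp
qed

lemma sets_leb: "sets leb = sets (vsig V)"
  and space_leb: "space leb = V"
  by (simp_all add: leb_def)

lemma emeasure_leb_coord_box:
  assumes "l \<le> u"
  shows "emeasure leb (coord_box l u) = ennreal (u - l) ^ m"
proof -
  have pre: "lincomb m v -` coord_box l u \<inter> space (Pi\<^sub>M {..<m} (\<lambda>_. lborel)) = PiE {..<m} (\<lambda>_. {l..u})"
  proof -
    have 1: "lincomb m v a \<in> coord_box l u \<longleftrightarrow> (\<forall>i<m. l \<le> a i \<and> a i \<le> u)" for a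
      by (simp add: coord_box_def inner_lincomb lincomb_in)
    have 2: "space (Pi\<^sub>M {..<m} (\<lambda>_. lborel :: real measure)) = PiE {..<m} (\<lambda>_. UNIV)"
      by (simp add: space_PiM)
    show ?thesis
      unfolding 2 using 1 by (auto simp: PiE_def Pi_def)
  qed
  have "emeasure leb (coord_box l u) = emeasure (Pi\<^sub>M {..<m} (\<lambda>_. lborel)) (PiE {..<m} (\<lambda>_. {l..u}))"
    unfolding leb_def by (simp only: emeasure_distr[OF lincomb_measurable coord_box_sets] pre)
  also have "\<dots> = (\<Prod>i<m. emeasure lborel {l..u})"
    by (rule lborel_product.emeasure_PiM) auto
  finally show ?thesis using assms by simp
qed

text \<open>Translation by \<open>x\<close> is translation by the coordinates of \<open>x\<close>; and a compact set lies in a box, as each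
  coordinate is bounded on it.\<close>

lemma leb_haar: "haar_measure V leb"
  unfolding haar_measure_def
proof (intro conjI ballI allI impI)
  show "space leb = V" by (rule space_leb)
  show "sets leb = sigma_sets V {U. openin (vtop V) U}" by (simp add: sets_leb sets_vsig)
next
  fix x A assume x: "x \<in> V" and "A \<in> sets leb"
  then have A: "A \<in> sets (vsig V)" by (simp add: sets_leb)
  then have AV: "A \<subseteq> V" using sets.sets_into_space[OF A] by simp
  let ?L = "Pi\<^sub>M {..<m} (\<lambda>_. lborel :: real measure)"
  define b where "b i = laurent_inner x (v i)" for i
  let ?T = "\<lambda>a. \<lambda>i\<in>{..<m}. b i + a i"
  have T: "?T \<in> measurable ?L ?L"
    by (rule measurable_restrict) measurable
  have xa: "lincomb m v (?T a) = x + lincomb m v a" for a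
  proof -
    have "x + lincomb m v a = lincomb m v b + lincomb m v a"
      unfolding b_def expand[OF x] ..
    also have "\<dots> = lincomb m v (?T a)"
      unfolding lincomb_add by (rule lincomb_cong) simp
    finally show ?thesis ..
  qed
  have meas: "(+) x ` A \<in> sets (vsig V)"
  proof -
    have "(+) x ` A = (+) (- x) -` A \<inter> V"
    proof safe
      fix y assume "y \<in> A"
      then show "x + y \<in> V" using AV x rvs.subspace_add[OF subspace] by blast
    next
      fix y assume "- x + y \<in> A"
      then show "y \<in> (+) x ` A" by (intro image_eqI[of _ _ "- x + y"]) simp_all
    qed simp
    moreover have "(+) (- x) \<in> measurable (vsig V) (vsig V)"
    proof (rule measurable_vsigI)
      fix y assume "y \<in> space (vsig V)"
      then show "- x + y \<in> V"
        using rvs.subspace_add[OF subspace rvs.subspace_neg[OF subspace x]] by simp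
    qed simp
    ultimately show ?thesis using measurable_sets[of "(+) (- x)" "vsig V" "vsig V" A] A by simp
  qed
  have pre: "?T -` (lincomb m v -` ((+) x ` A) \<inter> space ?L) \<inter> space ?L = lincomb m v -` A \<inter> space ?L"
  proof -
    have "?T a \<in> space ?L" if "a \<in> space ?L" for a using measurable_space[OF T that] .
    moreover have "lincomb m v (?T a) \<in> (+) x ` A \<longleftrightarrow> lincomb m v a \<in> A" for a
      unfolding xa by auto
    ultimately show ?thesis by blast
  qed
  have "emeasure leb ((+) x ` A) = emeasure ?L (lincomb m v -` ((+) x ` A) \<inter> space ?L)"
    unfolding leb_def by (rule emeasure_distr[OF lincomb_measurable meas])
  also have "\<dots> = emeasure (distr ?L ?L ?T) (lincomb m v -` ((+) x ` A) \<inter> space ?L)"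
    by (simp add: PiM_lborel_translate)
  also have "\<dots> = emeasure ?L (lincomb m v -` A \<inter> space ?L)"
    using measurable_sets[OF lincomb_measurable meas] by (subst emeasure_distr[OF T]) (simp_all only: pre)
  also have "\<dots> = emeasure leb A"
    unfolding leb_def by (rule emeasure_distr[OF lincomb_measurable A, symmetric])
  finally show "emeasure leb ((+) x ` A) = emeasure leb A" .
next
  fix C assume C: "compactin (vtop V) C"
  then have CV: "C \<subseteq> V" by (simp add: compactin_def)
  have "\<forall>i<m. \<exists>r. \<forall>x\<in>C. \<bar>laurent_inner x (v i)\<bar> \<le> r"
  proof (intro allI impI)
    fix i assume "i < m"
    then have "compactin euclideanreal ((\<lambda>x. laurent_inner x (v i)) ` C)"
      by (intro image_compactin[OF C] inner_continuous)
    then have "bounded ((\<lambda>x. laurent_inner x (v i)) ` C)"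
      by (simp add: compact_imp_bounded)
    then show "\<exists>r. \<forall>x\<in>C. \<bar>laurent_inner x (v i)\<bar> \<le> r"
      by (auto simp: bounded_iff)
  qed
  then obtain r where r: "\<And>i x. i < m \<Longrightarrow> x \<in> C \<Longrightarrow> \<bar>laurent_inner x (v i)\<bar> \<le> r i" by metis
  define R where "R = (\<Sum>i<m. \<bar>r i\<bar>)"
  have R: "\<bar>r i\<bar> \<le> R" if "i < m" for i
    unfolding R_def using that by (intro member_le_sum[of i _ "\<lambda>i. \<bar>r i\<bar>"]) auto
  have "C \<subseteq> coord_box (- R) R"
  proof
    fix x assume x: "x \<in> C"
    have "- R \<le> laurent_inner x (v i) \<and> laurent_inner x (v i) \<le> R" if "i < m" for i
      using r[OF that x] R[OF that] by linarith
    then show "x \<in> coord_box (- R) R" using x CV by (auto simp: coord_box_def)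
  qed
  then have "emeasure leb C \<le> emeasure leb (coord_box (- R) R)"
    by (rule emeasure_mono) (simp add: sets_leb coord_box_sets)
  also have "\<dots> < \<infinity>"
  proof -
    have "0 \<le> R" by (simp add: R_def sum_nonneg)
    then have "emeasure leb (coord_box (- R) R) = ennreal ((R - - R) ^ m)"
      by (subst emeasure_leb_coord_box) (simp_all add: ennreal_power)
    then show ?thesis by simp
  qed
  finally show "emeasure leb C < \<infinity>" .
next
  have "1 = emeasure leb (coord_box 0 1)" by (simp add: emeasure_leb_coord_box)
  also have "\<dots> \<le> emeasure leb V"
    using sets.top[of leb] by (intro emeasure_mono) (auto simp: coord_box_def space_leb)
  finally show "emeasure leb V \<noteq> 0" by auto
qed

lemma haar_coord_box_finite:
  assumes "haar_measure V \<mu>" "l \<le> u"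
  shows "emeasure \<mu> (coord_box l u) < \<infinity>"
  using assms coord_box_compact by (auto simp: haar_measure_def)

lemma haar_sigma_finite:
  assumes mu: "haar_measure V \<mu>"
  shows "sigma_finite_measure \<mu>"
proof
  have "(\<Union>n. coord_box (- real n) (real n)) = V"
  proof safe
    fix x assume x: "x \<in> V"
    obtain n where n: "(\<Sum>i<m. \<bar>laurent_inner x (v i)\<bar>) \<le> real n" using real_arch_simple by blast
    have "- real n \<le> laurent_inner x (v i) \<and> laurent_inner x (v i) \<le> real n" if "i < m" for i
    proof -
      have "\<bar>laurent_inner x (v i)\<bar> \<le> (\<Sum>i<m. \<bar>laurent_inner x (v i)\<bar>)"
        by (rule member_le_sum) (use that in auto)
      then show ?thesis using n by linarith
    qed
    then have "x \<in> coord_box (- real n) (real n)" using x by (simp add: coord_box_def)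
    then show "x \<in> (\<Union>n. coord_box (- real n) (real n))" by blast
  qed (auto simp: coord_box_def)
  then show "\<exists>A. countable A \<and> A \<subseteq> sets \<mu> \<and> \<Union> A = space \<mu> \<and> (\<forall>a\<in>A. emeasure \<mu> a \<noteq> \<infinity>)"
    using haar_coord_box_finite[OF mu]
    by (intro exI[of _ "range (\<lambda>n. coord_box (- real n) (real n))"])
       (auto simp: haar_space[OF mu] haar_sets[OF mu] coord_box_sets less_top[symmetric])
qed

lemma haar_eq_scale:
  assumes mu: "haar_measure V \<mu>"
  shows "\<mu> = scale_measure (emeasure \<mu> (coord_box 0 1)) leb"
proof (rule measure_eqI)
  fix A assume "A \<in> sets \<mu>"
  then have "A \<in> sets (vsig V)" by (simp add: haar_sets[OF mu])
  then show "emeasure \<mu> A = emeasure (scale_measure (emeasure \<mu> (coord_box 0 1)) leb) A"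
    using haar_unique[OF subspace mu leb_haar haar_sigma_finite[OF mu] haar_sigma_finite[OF leb_haar] coord_box_sets, of 0 1]
    by (simp add: emeasure_leb_coord_box)
qed (simp add: haar_sets[OF mu] sets_leb)

lemma nn_integral_leb_gauss:
  assumes "c > 0"
  shows "(\<integral>\<^sup>+x. ennreal (gauss c x) \<partial>leb) = ennreal (c powr (- real m / 2))"
proof -
  let ?L = "Pi\<^sub>M {..<m} (\<lambda>_. lborel :: real measure)"
  have [measurable]: "gauss c \<in> borel_measurable (vsig V)"
    by (rule gauss_measurable) (rule measurable_nth)
  have "(\<integral>\<^sup>+x. ennreal (gauss c x) \<partial>leb) = (\<integral>\<^sup>+a. ennreal (gauss c (lincomb m v a)) \<partial>?L)"
    unfolding leb_def by (rule nn_integral_distr[OF lincomb_measurable]) measurable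
  also have "\<dots> = (\<integral>\<^sup>+a. (\<Prod>i<m. ennreal (exp (- pi * c * (a i)\<^sup>2))) \<partial>?L)"
    by (intro nn_integral_cong) (simp add: gauss_def nsq_lincomb sum_distrib_left sum_negf[symmetric] exp_sum prod_ennreal)
  also have "\<dots> = (\<Prod>i<m. \<integral>\<^sup>+x. ennreal (exp (- pi * c * x\<^sup>2)) \<partial>lborel)"
    by (rule lborel_product.product_nn_integral_prod) auto
  also have "\<dots> = ennreal ((c powr (- 1 / 2)) ^ m)"
    using nn_integral_gaussian[OF assms] by (simp add: ennreal_power)
  also have "(c powr (- 1 / 2)) ^ m = c powr (- real m / 2)"
    using assms by (simp add: powr_realpow[symmetric] powr_powr)
  finally show ?thesis .
qed

end

text \<open>By uniqueness the two measures differ by a scalar.  The Gaussian integral is \<open>1\<close> for both, since it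
  depends only on the dimension; so the scalar is \<open>1\<close>.  This takes the place of the determinant of the
  orthogonal change of basis.\<close>

lemma leb_orthonormal_unique:
  assumes "onb V m v" "onb V k w"
  shows "onb.leb V m v = onb.leb V k w"
proof -
  interpret a: onb V m v by fact
  interpret b: onb V k w by fact
  have mk: "m = k" using a.dim_eq b.dim_eq by simp
  define r where "r = emeasure b.leb (a.coord_box 0 1)"
  have *: "b.leb = scale_measure r a.leb" unfolding r_def by (rule a.haar_eq_scale[OF b.leb_haar])
  have [measurable]: "gauss 1 \<in> borel_measurable a.leb"
    by (rule gauss_measurable) (simp add: measurable_cong_sets[OF a.sets_leb refl])
  have "1 = (\<integral>\<^sup>+x. ennreal (gauss 1 x) \<partial>b.leb)" by (simp add: b.nn_integral_leb_gauss)
  also have "\<dots> = r * (\<integral>\<^sup>+x. ennreal (gauss 1 x) \<partial>a.leb)"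
    unfolding * by (rule nn_integral_scale_measure) measurable
  also have "\<dots> = r" by (simp add: a.nn_integral_leb_gauss)
  finally have "r = 1" ..
  then show ?thesis using * by (simp add: scale_measure_1)
qed

context onb
begin

lemma induced_haar_eq: "induced_haar V = leb"
  unfolding induced_haar_def
proof (rule the_equality)
  have "emeasure leb {lincomb k w a |a. \<forall>i<k. 0 \<le> a i \<and> a i \<le> 1} = 1"
    if "orthonormal_basis V k w" for k w
  proof -
    interpret b: onb V k w by unfold_locales (use that sub in auto)
    have "leb = b.leb" by (rule leb_orthonormal_unique) unfold_locales
    then show ?thesis using b.emeasure_leb_coord_box[of 0 1] by (simp add: b.coord_box_eq)
  qed
  then show "haar_measure V leb \<and> (\<forall>k w. orthonormal_basis V k w \<longrightarrow>
      emeasure leb {lincomb k w a |a. \<forall>i<k. 0 \<le> a i \<and> a i \<le> 1} = 1)"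
    using leb_haar by blast
next
  fix \<mu> assume mu: "haar_measure V \<mu> \<and> (\<forall>k w. orthonormal_basis V k w \<longrightarrow>
      emeasure \<mu> {lincomb k w a |a. \<forall>i<k. 0 \<le> a i \<and> a i \<le> 1} = 1)"
  then have "emeasure \<mu> (coord_box 0 1) = 1" using basis by (simp add: coord_box_eq)
  then show "\<mu> = leb" using haar_eq_scale[of \<mu>] mu by (simp add: scale_measure_1)
qed

end

section \<open>The space of a unitary loop\<close>

lemma R_ring_mult: "f \<in> R_ring \<Longrightarrow> g \<in> R_ring \<Longrightarrow> f * g \<in> R_ring"
  by (auto simp: R_ring_def fls_times_fps_to_fls[symmetric])

lemma R_ring_sum: "(\<And>i. i \<in> A \<Longrightarrow> f i \<in> R_ring) \<Longrightarrow> sum f A \<in> R_ring"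
  by (auto simp: R_ring_iff fls_nth_sum)

lemma Mat_R_R_vec: "h \<in> Mat_R \<Longrightarrow> r \<in> R_vec \<Longrightarrow> h *v r \<in> R_vec"
  by (auto simp: R_vec_def Mat_R_def matrix_vector_mult_def intro!: R_ring_sum R_ring_mult)

lemma R_vec_add: "x \<in> R_vec \<Longrightarrow> y \<in> R_vec \<Longrightarrow> x + y \<in> R_vec"
  and R_vec_diff: "x \<in> R_vec \<Longrightarrow> y \<in> R_vec \<Longrightarrow> x - y \<in> R_vec"
  by (auto simp: R_vec_iff)

lemma Mat_R_inverse:
  assumes "h \<in> Mat_R"
  shows "matrix_inv h ** h = mat 1" "h ** matrix_inv h = mat 1"
proof -
  have "invertible h" using assms by (simp add: Mat_R_def invertible_det_nz)
  then show "matrix_inv h ** h = mat 1" "h ** matrix_inv h = mat 1"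
    using matrix_inv_eq_right_inverse matrix_left_right_inverse unfolding invertible_def by metis+
qed

lemma Vsp_iff:
  assumes "h \<in> Mat_R"
  shows "x \<in> Vsp h \<longleftrightarrow> x \<in> R_minus \<and> h *v x \<in> R_vec"
proof -
  have 1: "matrix_inv h *v (h *v y) = y" "h *v (matrix_inv h *v y) = y" for y
    by (simp_all add: matrix_vector_mul_assoc Mat_R_inverse[OF assms])
  show ?thesis
  proof
    assume "x \<in> Vsp h"
    then show "x \<in> R_minus \<and> h *v x \<in> R_vec" by (auto simp: Vsp_def 1)
  next
    assume "x \<in> R_minus \<and> h *v x \<in> R_vec"
    then show "x \<in> Vsp h"
      unfolding Vsp_def using 1(1)[of x] by (intro IntI image_eqI[of _ _ "h *v x"]) auto
  qed
qed

lemma matrix_vector_mult_rscale: "h *v rscale r x = rscale r (h *v x)"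
  by (simp add: vec_eq_iff matrix_vector_mult_def rscale_def sum_distrib_left mult_ac)

lemma Vsp_subspace:
  assumes "h \<in> Mat_R"
  shows "rvs.subspace (Vsp h)"
  unfolding rvs.subspace_def
  by (auto simp: Vsp_iff[OF assms] R_minus_0 R_minus_add R_minus_rscale matrix_vector_right_distrib R_vec_add
      matrix_vector_mult_rscale R_vec_iff)

lemma Vsp_sub: "Vsp h \<subseteq> R_minus"
  by (auto simp: Vsp_def)

text \<open>The loops \<open>t^l g\<close> of the construction of \<open>s(g)\<close>: orthogonal and without negative powers of \<open>t\<close>.\<close>

locale polynomial_loop =
  fixes h :: "'n::finite Fmat"
  assumes uni: "unitary_loop h" and MatR: "h \<in> Mat_R"
begin

lemma laurent: "laurent_poly (h $ i $ j)"
  using uni by (simp add: unitary_loop_def)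

lemma inv_eq: "matrix_inv h = flip_transpose h"
  by (rule unitary_loop_inv[OF uni])

lemma inv_mult [simp]: "matrix_inv h *v (h *v y) = y" "h *v (matrix_inv h *v y) = y"
  by (simp_all add: matrix_vector_mul_assoc Mat_R_inverse[OF MatR])

lemma nonneg: "k < 0 \<Longrightarrow> h $ i $ j $$ k = 0"
  using MatR by (auto simp: Mat_R_def R_ring_iff)

lemma degree_bound:
  obtains N :: nat where "\<And>i j k. k \<ge> int N \<Longrightarrow> h $ i $ j $$ k = 0"
proof -
  have "finite (\<Union>i j. {k. h $ i $ j $$ k \<noteq> 0})"
    using laurent by (auto simp: laurent_poly_def)
  then have "finite (nat ` (\<Union>i j. {k. h $ i $ j $$ k \<noteq> 0}))" by simp
  then obtain N where "\<forall>n \<in> nat ` (\<Union>i j. {k. h $ i $ j $$ k \<noteq> 0}). n < N"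
    using finite_nat_set_iff_bounded by blast
  then show ?thesis by (intro that[of N]) force
qed

text \<open>The inverse is the adjoint of \<open>h\<close>, so it is a polynomial in \<open>1/t\<close>.\<close>

lemma inv_R_minus:
  assumes "x \<in> R_minus"
  shows "matrix_inv h *v x \<in> R_minus"
  unfolding R_minus_iff
proof (intro allI impI)
  fix j and n :: int assume n: "0 \<le> n"
  obtain N where N: "\<And>i j k. k \<ge> int N \<Longrightarrow> h $ i $ j $$ k = 0" using degree_bound by blast
  have "(flip_t (h $ i $ j) * x $ i) $$ n = 0" for i
  proof -
    have "(flip_t (h $ i $ j) * x $ i) $$ n = (\<Sum>k\<in>{- int N..0}. flip_t (h $ i $ j) $$ k * x $ i $$ (n - k))"
      by (rule fls_times_nth_finite) (auto simp: flip_t_nth laurent N nonneg not_le)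
    also have "\<dots> = 0"
      using assms n by (intro sum.neutral) (auto simp: R_minus_iff)
    finally show ?thesis .
  qed
  then show "(matrix_inv h *v x) $ j $$ n = 0"
    by (simp add: inv_eq matrix_vector_mult_def fls_nth_sum)
qed

lemma inner_inv: "laurent_vec y \<Longrightarrow> laurent_inner (matrix_inv h *v x) y = laurent_inner x (h *v y)"
  unfolding inv_eq by (rule laurent_inner_flip_transpose[OF laurent])

text \<open>Moving \<open>h\<close> to the other side leaves the product of a principal part with the regular vector \<open>h y\<close>.\<close>

lemma inv_orthogonal:
  assumes "x \<in> R_minus" "y \<in> Vsp h"
  shows "laurent_inner (matrix_inv h *v x) y = 0"
proof -
  have y: "y \<in> R_minus" "h *v y \<in> R_vec" using assms Vsp_iff[OF MatR] by auto
  have lv: "laurent_vec x" "laurent_vec y" using assms y R_minus_laurent_vec by auto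
  have "laurent_inner (matrix_inv h *v x) y = laurent_inner (h *v y) x"
    using lv by (simp add: inner_inv laurent_inner_commute laurent_vec_mult laurent)
  then show ?thesis using R_vec_R_minus_orthogonal[OF y(2) assms(1)] by simp
qed

lemma inv_isometry:
  assumes "x \<in> R_minus"
  shows "nsq (matrix_inv h *v x) = nsq x"
  using assms by (simp add: nsq_R_minus inv_R_minus inner_inv R_minus_laurent_vec)

text \<open>A regular summand of the argument changes \<open>h\<^sup>-\<^sup>1 x\<close> by an element of \<open>V\<^sub>h\<close>, up to regular vectors;
  so it only translates the variable of integration.\<close>

lemma neg_part_inv_R_vec:
  assumes "r \<in> R_vec"
  shows "neg_part (matrix_inv h *v r) \<in> Vsp h"
proof -
  let ?u = "matrix_inv h *v r"
  have "h *v neg_part ?u = r - h *v (?u - neg_part ?u)"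
    by (simp add: matrix_vector_mult_diff_distrib)
  also have "\<dots> \<in> R_vec"
    by (intro R_vec_diff assms Mat_R_R_vec MatR diff_neg_part_in)
  finally show ?thesis using Vsp_iff[OF MatR] by simp
qed

text \<open>After the regular part of \<open>x\<close> has been removed by a translation, \<open>h\<^sup>-\<^sup>1 x\<close> is orthogonal to \<open>y\<close> and
  has the norm of \<open>x\<close>; so the Gaussian splits into a product.\<close>

lemma nn_integral_gauss_inv:
  assumes mu: "haar_measure (Vsp h) \<mu>"
  shows "(\<integral>\<^sup>+y. ennreal (gauss c (matrix_inv h *v x + y)) \<partial>\<mu>) =
    ennreal (gauss c x) * (\<integral>\<^sup>+y. ennreal (gauss c y) \<partial>\<mu>)"
proof -
  define p where "p = matrix_inv h *v neg_part x"
  define u where "u = matrix_inv h *v (x - neg_part x)"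
  define q where "q = neg_part u"
  have q: "q \<in> Vsp h" unfolding q_def u_def by (intro neg_part_inv_R_vec diff_neg_part_in)
  have split: "matrix_inv h *v x + y = (p + (q + y)) + (u - neg_part u)" for y
    unfolding p_def u_def q_def by (simp add: matrix_vector_mult_diff_distrib)
  have p: "p \<in> R_minus" unfolding p_def by (rule inv_R_minus) simp
  have "(\<integral>\<^sup>+y. ennreal (gauss c (matrix_inv h *v x + y)) \<partial>\<mu>) =
      (\<integral>\<^sup>+y. ennreal (gauss c (p + (q + y))) \<partial>\<mu>)"
    unfolding split gauss_def nsq_periodic[OF diff_neg_part_in] ..
  also have "\<dots> = (\<integral>\<^sup>+y. ennreal (gauss c (p + y)) \<partial>\<mu>)"
  proof (rule haar_nn_integral_translate[OF Vsp_subspace[OF MatR] mu q])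
    show "(\<lambda>y. ennreal (gauss c (p + y))) \<in> borel_measurable (vsig (Vsp h))"
      by (rule measurable_compose[OF gauss_measurable measurable_ennreal]) simp
  qed
  also have "\<dots> = (\<integral>\<^sup>+y. ennreal (gauss c x) * ennreal (gauss c y) \<partial>\<mu>)"
  proof (rule nn_integral_cong)
    fix y assume "y \<in> space \<mu>"
    then have y: "y \<in> Vsp h" by (simp add: haar_space[OF mu])
    then have "laurent_inner p y = 0" unfolding p_def by (intro inv_orthogonal) simp_all
    then have "nsq (p + y) = nsq x + nsq y"
      using nsq_add_orthogonal[OF p, of y] y Vsp_sub[of h] by (auto simp: p_def inv_isometry)
    then show "ennreal (gauss c (p + y)) = ennreal (gauss c x) * ennreal (gauss c y)"
      by (simp add: gauss_def ennreal_mult[symmetric] exp_add[symmetric] algebra_simps)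
  qed
  also have "\<dots> = ennreal (gauss c x) * (\<integral>\<^sup>+y. ennreal (gauss c y) \<partial>\<mu>)"
  proof (rule nn_integral_cmult)
    have "gauss c \<in> borel_measurable \<mu>"
      by (rule gauss_measurable) (simp add: measurable_cong_sets[OF haar_sets[OF mu] refl])
    then show "(\<lambda>y. ennreal (gauss c y)) \<in> borel_measurable \<mu>" by measurable
  qed
  finally show ?thesis .
qed

definition monomial :: "'n \<Rightarrow> nat \<Rightarrow> 'n Fvec" where
  "monomial j i = (\<chi> j'. if j' = j then fls_X_intpow (- int (Suc i)) else 0)"

lemma monomial_nth: "monomial j i $ j' $$ k = (if j' = j \<and> k = - int (Suc i) then 1 else 0)"
  by (auto simp: monomial_def)

lemma monomial_in: "monomial j i \<in> R_minus"
  by (auto simp: R_minus_iff monomial_nth)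

text \<open>As \<open>h y\<close> is regular and \<open>h\<^sup>-\<^sup>1\<close> involves only bounded powers of \<open>1/t\<close>, so does \<open>y = h\<^sup>-\<^sup>1 (h y)\<close>.\<close>

lemma Vsp_bound:
  "\<exists>N :: nat. (\<forall>i j k. k \<ge> int N \<longrightarrow> h $ i $ j $$ k = 0) \<and>
    (\<forall>y j k. y \<in> Vsp h \<longrightarrow> k < - int N \<longrightarrow> y $ j $$ k = 0)"
proof -
  obtain N where N: "\<And>i j k. k \<ge> int N \<Longrightarrow> h $ i $ j $$ k = 0" using degree_bound by blast
  show ?thesis
  proof (intro exI[of _ N] conjI allI impI)
    fix y j k assume "y \<in> Vsp h" and k: "k < - int N"
    then have r: "h *v y \<in> R_vec" using Vsp_iff[OF MatR] by blast
    have "(flip_t (h $ i $ j) * (h *v y) $ i) $$ k = 0" for i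
    proof -
      have "(flip_t (h $ i $ j) * (h *v y) $ i) $$ k =
          (\<Sum>l\<in>{- int N..0}. flip_t (h $ i $ j) $$ l * (h *v y) $ i $$ (k - l))"
        by (rule fls_times_nth_finite) (auto simp: flip_t_nth laurent N nonneg not_le)
      also have "\<dots> = 0"
        using r k by (intro sum.neutral) (auto simp: R_vec_iff)
      finally show ?thesis .
    qed
    then have "(matrix_inv h *v (h *v y)) $ j $$ k = 0"
      unfolding inv_eq matrix_vector_mult_def[of "flip_transpose h"] by (simp add: fls_nth_sum)
    then show "y $ j $$ k = 0" by simp
  qed (rule N)
qed

lemma ex_onb: "\<exists>m v. onb (Vsp h) m v"
proof -
  obtain N :: nat where "\<forall>y j k. y \<in> Vsp h \<longrightarrow> k < - int N \<longrightarrow> y $ j $$ k = 0"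
    using Vsp_bound by (elim exE conjE)
  then have N: "\<And>y j k. y \<in> Vsp h \<Longrightarrow> k < - int N \<Longrightarrow> y $ j $$ k = 0" by simp
  let ?T = "(\<lambda>(j, i). monomial j i) ` (UNIV \<times> {..<N})"
  have VT: "Vsp h \<subseteq> rvs.span ?T"
  proof
    fix y assume y: "y \<in> Vsp h"
    have "y = (\<Sum>j\<in>UNIV. \<Sum>i<N. rscale (y $ j $$ (- int (Suc i))) (monomial j i))"
    proof (rule Fvec_eqI)
      fix j k
      have "(\<Sum>j\<in>UNIV. \<Sum>i<N. rscale (y $ j $$ (- int (Suc i))) (monomial j i)) $ j $$ k
          = (\<Sum>j'\<in>UNIV. \<Sum>i<N. if j' = j then (if k = - int (Suc i) then y $ j $$ k else 0) else 0)"
        unfolding Fvec_sum_nth by (intro sum.cong refl) (auto simp: monomial_nth)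
      also have "\<dots> = (\<Sum>j'\<in>UNIV. if j' = j then (\<Sum>i<N. if k = - int (Suc i) then y $ j $$ k else 0) else 0)"
        by (intro sum.cong refl) auto
      also have "\<dots> = (\<Sum>i<N. if k = - int (Suc i) then y $ j $$ k else 0)"
        by simp
      also have "\<dots> = y $ j $$ k"
      proof (cases "- int N \<le> k \<and> k < 0")
        case True
        then have "(\<Sum>i<N. if k = - int (Suc i) then y $ j $$ k else 0) =
            (\<Sum>i<N. if i = nat (- k - 1) then y $ j $$ k else 0)"
          by (intro sum.cong refl if_cong) auto
        also have "\<dots> = y $ j $$ k" using True by (auto simp: sum.delta)
        finally show ?thesis .
      next
        case False
        then have "y $ j $$ k = 0" using N[OF y, of k j] y Vsp_sub[of h] by (auto simp: R_minus_iff not_le)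
        then show ?thesis by (simp only: if_cancel sum.neutral_const)
      qed
      finally show "y $ j $$ k = (\<Sum>j\<in>UNIV. \<Sum>i<N. rscale (y $ j $$ (- int (Suc i))) (monomial j i)) $ j $$ k" ..
    qed
    also have "\<dots> \<in> rvs.span ?T"
      by (intro rvs.span_sum rvs.span_scale rvs.span_base) auto
    finally show "y \<in> rvs.span ?T" .
  qed
  obtain B where B: "B \<subseteq> Vsp h" "rvs.independent B" "Vsp h \<subseteq> rvs.span B"
    by (rule rvs.basis_exists[of "Vsp h"])
  have "B \<subseteq> rvs.span ?T" by (rule subset_trans[OF B(1) VT])
  then have fin: "finite B"
    using rvs.independent_span_bound[OF _ B(2), of ?T] by simp
  obtain m v where ob: "orthonormal_basis (rvs.span B) m v"
    using gram_schmidt[OF fin B(2) subset_trans[OF B(1) Vsp_sub]] by (elim exE)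
  have "rvs.span B = Vsp h"
    using rvs.span_minimal[OF B(1) Vsp_subspace[OF MatR]] B(3) by (rule subset_antisym)
  then have "onb (Vsp h) m v"
    using ob by (intro onb.intro Vsp_sub) simp
  then show ?thesis by blast
qed

text \<open>The principal parts are the orthogonal sum of \<open>V\<^sub>h\<close> and of their image under \<open>h\<^sup>-\<^sup>1\<close>: the component of \<open>x\<close>
  in the image is \<open>h\<^sup>-\<^sup>1\<close> applied to the principal part of \<open>h x\<close>.\<close>

lemma parseval:
  assumes "onb (Vsp h) m v" and x: "x \<in> R_minus"
  shows "nsq x = (\<Sum>a<m. (laurent_inner x (v a))\<^sup>2) + nsq (h *v x)"
proof -
  interpret onb "Vsp h" m v by fact
  define w where "w = neg_part (h *v x)"
  define z where "z = matrix_inv h *v w"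
  define y where "y = x - z"
  have w: "w \<in> R_minus" by (simp add: w_def)
  have z: "z \<in> R_minus" unfolding z_def by (rule inv_R_minus[OF w])
  have "h *v y = h *v x - w" by (simp add: y_def z_def matrix_vector_mult_diff_distrib)
  then have y: "y \<in> Vsp h"
    using diff_neg_part_in[of "h *v x"] x z by (simp add: Vsp_iff[OF MatR] w_def y_def R_minus_diff)
  have zv: "laurent_inner z u = 0" if "u \<in> Vsp h" for u
    unfolding z_def by (rule inv_orthogonal[OF w that])
  have "nsq x = nsq (z + y)" by (simp add: y_def)
  also have "\<dots> = nsq z + nsq y"
    using y sub by (intro nsq_add_orthogonal z zv) auto
  also have "nsq z = nsq (h *v x)" by (simp add: z_def inv_isometry w) (simp add: w_def)
  also have "nsq y = (\<Sum>a<m. (laurent_inner x (v a))\<^sup>2)"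
    unfolding nsq_expand[OF y] by (intro sum.cong refl) (simp add: y_def laurent_inner_diff_left zv basis_in)
  finally show ?thesis by simp
qed

lemma column_norm:
  assumes N: "\<And>i j k. k \<ge> int N \<Longrightarrow> h $ i $ j $$ k = 0"
  shows "(\<Sum>r\<in>UNIV. \<Sum>s<N. (h $ r $ j $$ int s)\<^sup>2) = 1"
proof -
  have "1 = (flip_transpose h ** h) $ j $ j $$ 0"
    by (simp add: unitary_loop_inv(2)[OF uni] mat_def)
  also have "\<dots> = (\<Sum>r\<in>UNIV. (h $ r $ j * flip_t (h $ r $ j)) $$ 0)"
    by (simp add: matrix_matrix_mult_def fls_nth_sum mult.commute)
  also have "\<dots> = (\<Sum>r\<in>UNIV. \<Sum>s<N. (h $ r $ j $$ int s)\<^sup>2)"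
  proof (rule sum.cong[OF refl])
    fix r
    have "(h $ r $ j * flip_t (h $ r $ j)) $$ 0 = (\<Sum>k\<in>int ` {..<N}. h $ r $ j $$ k * flip_t (h $ r $ j) $$ (0 - k))"
    proof (rule fls_times_nth_finite)
      fix k assume k: "k \<notin> int ` {..<N}"
      have "k < 0 \<or> k \<ge> int N"
      proof (rule ccontr)
        assume "\<not> ?thesis"
        then have "k = int (nat k)" "nat k < N" by auto
        then show False using k by blast
      qed
      then show "h $ r $ j $$ k = 0" using N nonneg by auto
    qed simp
    also have "\<dots> = (\<Sum>s<N. (h $ r $ j $$ int s)\<^sup>2)"
      by (subst sum.reindex) (auto simp: flip_t_nth laurent power2_eq_square)
    finally show "(h $ r $ j * flip_t (h $ r $ j)) $$ 0 = (\<Sum>s<N. (h $ r $ j $$ int s)\<^sup>2)" .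
  qed
  finally show ?thesis ..
qed

text \<open>The dimension is the trace of the orthogonal projection to \<open>V\<^sub>h\<close>.  For the monomial
  \<open>x = e\<^sub>j t\<^bsup>-(i+1)\<^esup>\<close>, the principal part of \<open>h x\<close> consists of the coefficients of degree at most \<open>i\<close> in
  column \<open>j\<close> of \<open>h\<close>; columns have norm \<open>1\<close>, so the projection of \<open>x\<close> has as squared norm the contribution
  of the degrees above \<open>i\<close>.  Summing over \<open>i\<close> counts the coefficient of degree \<open>s\<close> exactly \<open>s\<close> times.\<close>

lemma dim_eq_energy:
  assumes "onb (Vsp h) m v"
    and N: "\<And>i j k. k \<ge> int N \<Longrightarrow> h $ i $ j $$ k = 0"
    and NV: "\<And>y j k. y \<in> Vsp h \<Longrightarrow> k < - int N \<Longrightarrow> y $ j $$ k = 0"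
  shows "real m = (\<Sum>j\<in>UNIV. \<Sum>r\<in>UNIV. \<Sum>s<N. real s * (h $ r $ j $$ int s)\<^sup>2)"
proof -
  interpret onb "Vsp h" m v by fact
  have mono1: "(\<Sum>a<m. (v a $ j $$ (- int (Suc i)))\<^sup>2) = (\<Sum>r\<in>UNIV. \<Sum>s<N. if i < s then (h $ r $ j $$ int s)\<^sup>2 else 0)"
    if i: "i < N" for i j
  proof -
    have lv: "laurent_vec (monomial j i)" by (rule R_minus_laurent_vec[OF monomial_in])
    have inn: "laurent_inner u (monomial j i) = u $ j $$ (- int (Suc i))" for u
    proof -
      have "laurent_inner u (monomial j i) = (\<Sum>j'\<in>UNIV. \<Sum>k\<in>{- int (Suc i)}. u $ j' $$ k * monomial j i $ j' $$ k)"
        by (rule laurent_inner_nth) (auto simp: monomial_nth)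
      also have "\<dots> = (\<Sum>j'\<in>UNIV. if j' = j then u $ j $$ (- int (Suc i)) else 0)"
        by (intro sum.cong refl) (auto simp: monomial_nth)
      finally show ?thesis by simp
    qed
    have n1: "nsq (monomial j i) = 1"
      by (simp add: nsq_R_minus monomial_in inn monomial_nth)
    have hm: "(h *v monomial j i) $ r $$ k = h $ r $ j $$ (k + int (Suc i))" for r k
    proof -
      have "(h *v monomial j i) $ r = (\<Sum>j'\<in>UNIV. if j' = j then h $ r $ j * fls_X_intpow (- int (Suc i)) else 0)"
        unfolding matrix_vector_mult_def monomial_def vec_lambda_beta by (intro sum.cong refl) auto
      also have "\<dots> = h $ r $ j * fls_X_intpow (- int (Suc i))" by simp
      also have "\<dots> = fls_shift (int (Suc i)) (h $ r $ j)"
        using fls_X_intpow_times_conv_shift(2)[where i = "- int (Suc i)" and f = "h $ r $ j"] by (simp only: minus_minus)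
      finally show ?thesis by (simp only: fls_shift_nth)
    qed
    have "nsq (h *v monomial j i) = (\<Sum>r\<in>UNIV. \<Sum>s<N. if s \<le> i then (h $ r $ j $$ int s)\<^sup>2 else 0)"
      unfolding nsq_def
    proof (rule sum.cong[OF refl])
      fix r
      have "(\<Sum>k. ((h *v monomial j i) $ r $$ (- int (Suc k)))\<^sup>2) = (\<Sum>k\<le>i. ((h *v monomial j i) $ r $$ (- int (Suc k)))\<^sup>2)"
        by (rule suminf_finite) (auto simp: hm nonneg)
      also have "\<dots> = (\<Sum>k\<le>i. (h $ r $ j $$ int (i - k))\<^sup>2)"
        by (intro sum.cong refl) (auto simp: hm of_nat_diff algebra_simps)
      also have "\<dots> = (\<Sum>s\<le>i. (h $ r $ j $$ int s)\<^sup>2)"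
        by (rule sum.reindex_bij_witness[of _ "\<lambda>s. i - s" "\<lambda>k. i - k"]) auto
      also have "\<dots> = (\<Sum>s<N. if s \<le> i then (h $ r $ j $$ int s)\<^sup>2 else 0)"
        using i by (intro sum.mono_neutral_cong_left) auto
      finally show "(\<Sum>k. ((h *v monomial j i) $ r $$ (- int (Suc k)))\<^sup>2) =
          (\<Sum>s<N. if s \<le> i then (h $ r $ j $$ int s)\<^sup>2 else 0)" .
    qed
    then have "1 = (\<Sum>a<m. (v a $ j $$ (- int (Suc i)))\<^sup>2) +
        (\<Sum>r\<in>UNIV. \<Sum>s<N. if s \<le> i then (h $ r $ j $$ int s)\<^sup>2 else 0)"
      using parseval[OF assms(1) monomial_in, of j i] n1
        laurent_inner_commute[OF lv laurent_vec[OF basis_in]] by (simp add: inn)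
    moreover have "(\<Sum>r\<in>UNIV. \<Sum>s<N. if s \<le> i then (h $ r $ j $$ int s)\<^sup>2 else 0) +
        (\<Sum>r\<in>UNIV. \<Sum>s<N. if i < s then (h $ r $ j $$ int s)\<^sup>2 else 0) =
        (\<Sum>r\<in>UNIV. \<Sum>s<N. (h $ r $ j $$ int s)\<^sup>2)"
      unfolding sum.distrib[symmetric] by (intro sum.cong refl) auto
    moreover have "(\<Sum>r\<in>UNIV. \<Sum>s<N. (h $ r $ j $$ int s)\<^sup>2) = 1"
      by (rule column_norm[OF N])
    ultimately show ?thesis by linarith
  qed
  have "real m = (\<Sum>a<m. laurent_inner (v a) (v a))" by (simp add: orthonormal)
  also have "\<dots> = (\<Sum>a<m. \<Sum>j\<in>UNIV. \<Sum>i<N. (v a $ j $$ (- int (Suc i)))\<^sup>2)"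
  proof (rule sum.cong[OF refl])
    fix a assume a: "a \<in> {..<m}"
    have inj: "inj_on (\<lambda>i. - int (Suc i)) {..<N}" by (auto simp: inj_on_def)
    have "laurent_inner (v a) (v a) = (\<Sum>j\<in>UNIV. \<Sum>k\<in>(\<lambda>i. - int (Suc i)) ` {..<N}. v a $ j $$ k * v a $ j $$ k)"
    proof (rule laurent_inner_nth)
      fix j k assume k: "k \<notin> (\<lambda>i. - int (Suc i)) ` {..<N}"
      have "k \<ge> 0 \<or> k < - int N"
      proof (rule ccontr)
        assume "\<not> ?thesis"
        then have "k = - int (Suc (nat (- k - 1)))" "nat (- k - 1) < N" by auto
        then show False using k by blast
      qed
      then show "v a $ j $$ k = 0"
        using NV[OF basis_in] a basis_in[of a] sub by (auto simp: R_minus_iff)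
    qed simp
    then show "laurent_inner (v a) (v a) = (\<Sum>j\<in>UNIV. \<Sum>i<N. (v a $ j $$ (- int (Suc i)))\<^sup>2)"
      by (simp only: sum.reindex[OF inj] o_def power2_eq_square)
  qed
  also have "\<dots> = (\<Sum>j\<in>UNIV. \<Sum>a<m. \<Sum>i<N. (v a $ j $$ (- int (Suc i)))\<^sup>2)"
    by (rule sum.swap)
  also have "\<dots> = (\<Sum>j\<in>UNIV. \<Sum>i<N. \<Sum>a<m. (v a $ j $$ (- int (Suc i)))\<^sup>2)"
    by (rule sum.cong[OF refl], rule sum.swap)
  also have "\<dots> = (\<Sum>j\<in>UNIV. \<Sum>i<N. \<Sum>r\<in>UNIV. \<Sum>s<N. if i < s then (h $ r $ j $$ int s)\<^sup>2 else 0)"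
    by (intro sum.cong refl) (use mono1 in simp)
  also have "\<dots> = (\<Sum>j\<in>UNIV. \<Sum>r\<in>UNIV. \<Sum>i<N. \<Sum>s<N. if i < s then (h $ r $ j $$ int s)\<^sup>2 else 0)"
    by (rule sum.cong[OF refl], rule sum.swap)
  also have "\<dots> = (\<Sum>j\<in>UNIV. \<Sum>r\<in>UNIV. \<Sum>s<N. \<Sum>i<N. if i < s then (h $ r $ j $$ int s)\<^sup>2 else 0)"
    by (rule sum.cong[OF refl], rule sum.cong[OF refl], rule sum.swap)
  also have "\<dots> = (\<Sum>j\<in>UNIV. \<Sum>r\<in>UNIV. \<Sum>s<N. real s * (h $ r $ j $$ int s)\<^sup>2)"
  proof (intro sum.cong refl)
    fix j r s assume s: "s \<in> {..<N}"
    have "(\<Sum>i<N. if i < s then (h $ r $ j $$ int s)\<^sup>2 else 0) = (\<Sum>i<s. (h $ r $ j $$ int s)\<^sup>2)"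
      using s by (intro sum.mono_neutral_cong_right) auto
    then show "(\<Sum>i<N. if i < s then (h $ r $ j $$ int s)\<^sup>2 else 0) = real s * (h $ r $ j $$ int s)\<^sup>2" by simp
  qed
  finally show ?thesis .
qed

end

section \<open>The logarithmic derivative of a determinant\<close>

text \<open>The derivation \<open>t d/dt\<close>, which preserves degrees.\<close>

definition euler :: "real fls \<Rightarrow> real fls" where
  "euler f = fls_X * fls_deriv f"

lemma euler_nth [simp]: "euler f $$ k = of_int k * f $$ k"
  by (simp add: euler_def fls_X_times_conv_shift)

lemma euler_mult: "euler (f * g) = euler f * g + f * euler g"
  by (simp add: euler_def algebra_simps)

lemma euler_sum: "euler (sum f A) = (\<Sum>i\<in>A. euler (f i))"
  by (rule fls_eqI) (simp add: fls_nth_sum sum_distrib_left)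

lemma euler_of_int_mult: "euler (of_int z * f) = of_int z * euler f"
  by (rule fls_eqI) (simp add: fls_of_int)

lemma euler_prod:
  "finite A \<Longrightarrow> euler (prod f A) = (\<Sum>i\<in>A. \<Prod>j\<in>A. if j = i then euler (f j) else f j)"
proof (induction A rule: finite_induct)
  case empty
  show ?case by (rule fls_eqI) simp
next
  case (insert a A)
  have "(\<Prod>j\<in>A. if j = a then euler (f j) else f j) = prod f A"
    using insert by (intro prod.cong refl) auto
  moreover have "(\<Sum>i\<in>A. (if a = i then euler (f a) else f a) * (\<Prod>j\<in>A. if j = i then euler (f j) else f j))
      = f a * euler (prod f A)"
    unfolding insert.IH sum_distrib_left using insert by (intro sum.cong refl) auto
  ultimately show ?case using insert by (simp add: euler_mult)
qed

lemma euler_det_rows: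
  fixes A :: "'n::finite Fmat"
  shows "euler (det A) = (\<Sum>k\<in>UNIV. det (\<chi> i. if i = k then (\<chi> j. euler (A $ i $ j)) else A $ i))"
proof -
  let ?P = "{p. p permutes (UNIV :: 'n set)}"
  have "euler (det A) = (\<Sum>p\<in>?P. of_int (sign p) * (\<Sum>k\<in>UNIV. \<Prod>i\<in>UNIV. if i = k then euler (A $ i $ p i) else A $ i $ p i))"
    by (simp add: det_def euler_sum euler_of_int_mult euler_prod)
  also have "\<dots> = (\<Sum>k\<in>UNIV. \<Sum>p\<in>?P. of_int (sign p) * (\<Prod>i\<in>UNIV. if i = k then euler (A $ i $ p i) else A $ i $ p i))"
    unfolding sum_distrib_left by (rule sum.swap)
  also have "\<dots> = (\<Sum>k\<in>UNIV. det (\<chi> i. if i = k then (\<chi> j. euler (A $ i $ j)) else A $ i))"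
    unfolding det_def by (intro sum.cong refl arg_cong2[where f = "(*)"] prod.cong) auto
  finally show ?thesis .
qed

lemma det_replace_row:
  fixes A M :: "'a::field ^ 'n ^ 'n"
  shows "det (\<chi> i. if i = k then (M ** A) $ i else A $ i) = M $ k $ k * det A"
proof -
  have row: "(M ** A) $ k = (\<Sum>j\<in>UNIV. M $ k $ j *s A $ j)"
    by (simp add: vec_eq_iff matrix_matrix_mult_def)
  have "det (\<chi> i. if i = k then (M ** A) $ i else A $ i) =
      det (\<chi> i. if i = k then (\<Sum>j\<in>UNIV. M $ k $ j *s A $ j) else A $ i)"
    by (rule arg_cong[of _ _ det]) (simp add: vec_eq_iff row)
  also have "\<dots> = (\<Sum>j\<in>UNIV. det (\<chi> i. if i = k then M $ k $ j *s A $ j else A $ i))"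
    by (rule det_linear_row_sum) simp
  also have "\<dots> = (\<Sum>j\<in>UNIV. M $ k $ j * det (\<chi> i. if i = k then A $ j else A $ i))"
    by (simp add: det_row_mul)
  also have "\<dots> = (\<Sum>j\<in>UNIV. if j = k then M $ k $ k * det A else 0)"
  proof (intro sum.cong refl)
    fix j
    show "M $ k $ j * det (\<chi> i. if i = k then A $ j else A $ i) = (if j = k then M $ k $ k * det A else 0)"
    proof (cases "j = k")
      case True
      then have "(\<chi> i. if i = k then A $ j else A $ i) = A" by (simp add: vec_eq_iff)
      then show ?thesis using True by simp
    next
      case False
      then have "det (\<chi> i. if i = k then A $ j else A $ i) = 0"
        by (intro det_identical_rows[OF False]) (simp add: row_def)
      then show ?thesis using False by simp
    qed
  qed
  finally show ?thesis by simp
qed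

text \<open>Jacobi's formula: the row \<open>k\<close> of the derivative is the combination of the rows of \<open>A\<close> with coefficients
  from row \<open>k\<close> of the logarithmic derivative, and in the determinant only the multiple of row \<open>k\<close> itself
  survives.\<close>

lemma euler_det:
  fixes A :: "'n::finite Fmat"
  assumes "B ** A = mat 1"
  shows "euler (det A) = det A * (\<Sum>k\<in>UNIV. \<Sum>j\<in>UNIV. euler (A $ k $ j) * B $ j $ k)"
proof -
  define M where "M = (\<chi> i j. euler (A $ i $ j)) ** B"
  have MA: "M ** A = (\<chi> i j. euler (A $ i $ j))"
    by (simp add: M_def matrix_mul_assoc[symmetric] assms)
  have "euler (det A) = (\<Sum>k\<in>UNIV. det (\<chi> i. if i = k then (M ** A) $ i else A $ i))"
    unfolding euler_det_rows by (intro sum.cong refl arg_cong[of _ _ det]) (simp add: vec_eq_iff MA)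
  also have "\<dots> = (\<Sum>k\<in>UNIV. det A * M $ k $ k)"
    by (simp add: det_replace_row mult.commute)
  finally show ?thesis
    by (simp add: sum_distrib_left M_def matrix_matrix_mult_def)
qed

context polynomial_loop
begin

text \<open>The sum in \<open>dim_eq_energy\<close> is the constant term of the logarithmic derivative of \<open>h\<close>, because
  \<open>h\<^sup>-\<^sup>1\<close> is the adjoint of \<open>h\<close>.\<close>

lemma dim_eq_degree:
  assumes "onb (Vsp h) m v" and det: "det h = fls_X_intpow e"
  shows "real m = of_int e"
proof -
  obtain N :: nat where "\<forall>i j k. k \<ge> int N \<longrightarrow> h $ i $ j $$ k = 0"
    "\<forall>y j k. y \<in> Vsp h \<longrightarrow> k < - int N \<longrightarrow> y $ j $$ k = 0"
    using Vsp_bound by (elim exE conjE)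
  then have N: "\<And>i j k. k \<ge> int N \<Longrightarrow> h $ i $ j $$ k = 0"
    "\<And>y j k. y \<in> Vsp h \<Longrightarrow> k < - int N \<Longrightarrow> y $ j $$ k = 0" by simp_all
  let ?T = "\<Sum>r\<in>UNIV. \<Sum>j\<in>UNIV. euler (h $ r $ j) * flip_t (h $ r $ j)"
  have "euler (det h) = det h * ?T"
    using euler_det[OF unitary_loop_inv(2)[OF uni]] by simp
  moreover have "euler (det h) = det h * fls_const (of_int e)"
    unfolding det by (rule fls_eqI) (auto simp: fls_X_intpow_times_conv_shift)
  ultimately have "?T = fls_const (of_int e)"
    using det by simp
  then have "of_int e = ?T $$ 0" by simp
  also have "\<dots> = (\<Sum>r\<in>UNIV. \<Sum>j\<in>UNIV. \<Sum>s<N. real s * (h $ r $ j $$ int s)\<^sup>2)"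
    unfolding fls_nth_sum
  proof (intro sum.cong refl)
    fix r j
    have "(euler (h $ r $ j) * flip_t (h $ r $ j)) $$ 0 =
        (\<Sum>k\<in>int ` {..<N}. euler (h $ r $ j) $$ k * flip_t (h $ r $ j) $$ (0 - k))"
    proof (rule fls_times_nth_finite)
      fix k assume k: "k \<notin> int ` {..<N}"
      have "k < 0 \<or> k \<ge> int N"
      proof (rule ccontr)
        assume "\<not> ?thesis"
        then have "k = int (nat k)" "nat k < N" by auto
        then show False using k by blast
      qed
      then show "euler (h $ r $ j) $$ k = 0" using N(1) nonneg by auto
    qed simp
    also have "\<dots> = (\<Sum>s<N. real s * (h $ r $ j $$ int s)\<^sup>2)"
      by (subst sum.reindex) (auto simp: flip_t_nth laurent power2_eq_square mult.assoc)
    finally show "(euler (h $ r $ j) * flip_t (h $ r $ j)) $$ 0 = (\<Sum>s<N. real s * (h $ r $ j $$ int s)\<^sup>2)" .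
  qed
  also have "\<dots> = real m"
  proof (subst sum.swap, rule dim_eq_energy[OF assms(1), symmetric])
  qed (use N in auto)
  finally show ?thesis ..
qed

end

section \<open>Scalar loops\<close>

lemma tI_nth: "tI k $ i $ j = (if i = j then fls_X_intpow k else 0)"
  by (simp add: tI_def mat_def)

lemma tI_mult_nth: "(tI k ** g) $ i $ j = fls_X_intpow k * g $ i $ j"
proof -
  have "(tI k ** g) $ i $ j = (\<Sum>l\<in>UNIV. if i = l then fls_X_intpow k * g $ l $ j else 0)"
    unfolding matrix_matrix_mult_def vec_lambda_beta tI_nth by (intro sum.cong refl) auto
  then show ?thesis by simp
qed

lemma tI_tI: "tI a ** (tI b :: 'n::finite Fmat) = tI (a + b)"
proof -
  have "(tI a ** (tI b :: 'n Fmat)) $ i $ j = tI (a + b) $ i $ j" for i j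
    unfolding tI_mult_nth tI_nth using fls_X_intpow_times_fls_X_intpow[of a b] by auto
  then show ?thesis by (simp only: vec_eq_iff) simp
qed

lemma tI_0: "tI 0 = (mat 1 :: 'n::finite Fmat)"
  by (simp add: tI_def)

lemma det_tI: "det (tI k :: 'n::finite Fmat) = fls_X_intpow (int CARD('n) * k)"
proof -
  have "det (tI k :: 'n Fmat) = (\<Prod>i\<in>UNIV. (tI k :: 'n Fmat) $ i $ i)"
    by (rule det_diagonal) (simp add: tI_nth)
  also have "\<dots> = fls_X_intpow k ^ CARD('n)"
    unfolding tI_nth by simp
  finally show ?thesis by (simp only: fls_X_intpow_power)
qed

lemma unitary_loop_mult:
  assumes g: "unitary_loop g" and h: "unitary_loop h"
  shows "unitary_loop (g ** h)"
  unfolding unitary_loop_def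
proof (intro conjI allI)
  have lp: "laurent_poly (g $ i $ j)" "laurent_poly (h $ i $ j)" for i j
    using g h by (auto simp: unitary_loop_def)
  show "laurent_poly ((g ** h) $ i $ j)" for i j
    by (auto simp: matrix_matrix_mult_def lp intro!: laurent_poly_sum laurent_poly_mult)
  have "flip_transpose (g ** h) = flip_transpose h ** flip_transpose g"
    by (simp add: vec_eq_iff matrix_matrix_mult_def flip_t_sum flip_t_mult laurent_poly_mult lp mult.commute)
  then have "(g ** h) ** flip_transpose (g ** h) = g ** (h ** flip_transpose h) ** flip_transpose g"
    by (simp add: matrix_mul_assoc)
  also have "\<dots> = mat 1" using g h by (simp add: unitary_loop_def)
  finally show "(g ** h) ** flip_transpose (g ** h) = mat 1" .
qed

lemma unitary_loop_tI: "unitary_loop (tI k)"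
  unfolding unitary_loop_def
proof (intro conjI allI)
  show "laurent_poly ((tI k :: 'a Fmat) $ i $ j)" for i j by (auto simp: tI_nth)
  have "flip_transpose (tI k :: 'a Fmat) $ i $ j = tI (- k) $ i $ j" for i j
    unfolding flip_transpose_nth tI_nth by (auto simp del: minus_minus)
  then have "flip_transpose (tI k :: 'a Fmat) = tI (- k)" by (simp only: vec_eq_iff) simp
  then show "(tI k :: 'a Fmat) ** flip_transpose (tI k) = mat 1" by (simp only: tI_tI) (simp add: tI_0)
qed

lemma O_grp_unitary: "g \<in> O_grp \<Longrightarrow> unitary_loop g"
  by (auto simp: O_grp_def GL_laurent_def unitary_loop_def flip_transpose_def)

lemma tI_Mat_R: "(tI (int l) :: 'n::finite Fmat) \<in> Mat_R"
  by (auto simp: Mat_R_def det_tI tI_nth R_ring_iff)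

lemma tI_mult_Mat_R:
  assumes "h \<in> Mat_R"
  shows "tI (int l) ** h \<in> Mat_R"
  using assms tI_Mat_R[of l, unfolded Mat_R_def]
  by (auto simp: Mat_R_def det_mul tI_mult_nth intro!: R_ring_mult) (auto simp: R_ring_iff)

lemma polynomial_loop_tI: "polynomial_loop (tI (int l))"
  by unfold_locales (rule unitary_loop_tI, rule tI_Mat_R)

lemma matrix_inv_tI: "matrix_inv (tI k) = tI (- k)"
  by (rule matrix_inv_eq_right_inverse) (simp add: tI_tI tI_0)

section \<open>The action on the Gaussian\<close>

text \<open>Positivity of the Gaussian turns the action into an integral of a nonnegative function, to which Fubini
  applies without integrability conditions.\<close>

lemma rep_gaussian:
  assumes "sets \<mu> = sets (vsig V)"
  shows "rep (g, \<mu>) (gaussian c) x =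
    complex_of_real (enn2real (\<integral>\<^sup>+y. ennreal (gauss c (matrix_inv g *v x + y)) \<partial>\<mu>))"
proof -
  have "(\<lambda>y. gauss c (matrix_inv g *v x + y)) \<in> borel_measurable \<mu>"
    by (rule gauss_measurable) (simp add: measurable_cong_sets[OF assms refl])
  then have "(LINT y|\<mu>. gauss c (matrix_inv g *v x + y)) =
      enn2real (\<integral>\<^sup>+y. ennreal (gauss c (matrix_inv g *v x + y)) \<partial>\<mu>)"
    by (rule integral_eq_nn_integral) (simp add: gauss_pos less_imp_le)
  then show ?thesis by (simp add: gaussian_eq)
qed

context polynomial_loop
begin

lemma rep_gaussian_haar:
  assumes mu: "haar_measure (Vsp h) \<mu>"
  shows "rep (h, \<mu>) (gaussian c) x =
    complex_of_real (enn2real (\<integral>\<^sup>+y. ennreal (gauss c y) \<partial>\<mu>)) * gaussian c x"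
  unfolding rep_gaussian[OF haar_sets[OF mu]] nn_integral_gauss_inv[OF mu] enn2real_mult
  using gauss_pos[of c x] by (simp add: gaussian_eq)

lemma haar_induced: "haar_measure (Vsp h) (induced_haar (Vsp h))"
proof -
  obtain m v where "onb (Vsp h) m v" using ex_onb by blast
  then interpret onb "Vsp h" m v .
  show ?thesis by (simp add: induced_haar_eq leb_haar)
qed

text \<open>This is where the relation between \<open>c\<close> and \<open>lam\<close> enters: \<open>V\<^sub>h\<close> has dimension \<open>n l\<close>.\<close>

lemma nn_integral_induced:
  assumes "lam > 0" and c: "c = lam powr (- 2 / real CARD('n))"
    and det: "det h = fls_X_intpow (int CARD('n) * l)"
  shows "(\<integral>\<^sup>+y. ennreal (gauss c y) \<partial>induced_haar (Vsp h)) = ennreal (lam powi l)"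
proof -
  obtain m v where "onb (Vsp h) m v" using ex_onb by blast
  then interpret onb "Vsp h" m v .
  have m: "real m = real CARD('n) * of_int l"
    using dim_eq_degree[OF onb_axioms det] by simp
  have "c > 0" using assms by simp
  then have "(\<integral>\<^sup>+y. ennreal (gauss c y) \<partial>induced_haar (Vsp h)) = ennreal (c powr (- real m / 2))"
    by (simp add: induced_haar_eq nn_integral_leb_gauss)
  also have "c powr (- real m / 2) = lam powr (of_int l)"
    unfolding c m powr_powr by simp
  also have "\<dots> = lam powi l" using assms(1) by (simp add: powr_real_of_int')
  finally show ?thesis .
qed

lemma haar_sigma_finite:
  assumes "haar_measure (Vsp h) \<mu>"
  shows "sigma_finite_measure \<mu>"
proof -
  obtain m v where "onb (Vsp h) m v" using ex_onb by blast
  then interpret onb "Vsp h" m v .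
  show ?thesis by (rule haar_sigma_finite[OF assms])
qed

text \<open>The entries of \<open>h\<^sup>-\<^sup>1\<close> have finite support, so the coefficients of \<open>h\<^sup>-\<^sup>1 y\<close> are finite linear
  combinations of those of \<open>y\<close>.\<close>

lemma convolution_measurable:
  fixes l :: nat
  defines "V' \<equiv> Vsp (tI (int l) ** h)"
  shows "(\<lambda>(y, z). neg_part (matrix_inv h *v y + z)) \<in>
    measurable (vsig (Vsp (tI (int l))) \<Otimes>\<^sub>M vsig (Vsp h)) (vsig V')"
proof (rule measurable_vsigI)
  let ?h' = "tI (int l) ** h"
  have MR: "?h' \<in> Mat_R" by (rule tI_mult_Mat_R[OF MatR])
  fix \<omega> :: "'n Fvec \<times> 'n Fvec" assume "\<omega> \<in> space (vsig (Vsp (tI (int l))) \<Otimes>\<^sub>M vsig (Vsp h))"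
  then obtain y z where \<omega>: "\<omega> = (y, z)" "y \<in> Vsp (tI (int l))" "z \<in> Vsp h"
    by (auto simp: space_pair_measure)
  let ?w = "matrix_inv h *v y + z"
  have "?h' *v ?w = tI (int l) *v y + tI (int l) *v (h *v z)"
    by (simp add: matrix_vector_mul_assoc[symmetric] matrix_vector_right_distrib)
  moreover have "\<dots> \<in> R_vec"
  proof (rule R_vec_add)
    show "tI (int l) *v y \<in> R_vec" using \<omega>(2) by (simp add: Vsp_iff[OF tI_Mat_R])
    show "tI (int l) *v (h *v z) \<in> R_vec"
      by (rule Mat_R_R_vec[OF tI_Mat_R]) (use \<omega>(3) in \<open>simp add: Vsp_iff[OF MatR]\<close>)
  qed
  moreover have "?h' *v neg_part ?w = ?h' *v ?w - ?h' *v (?w - neg_part ?w)"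
    by (simp add: matrix_vector_mult_diff_distrib)
  ultimately have "?h' *v neg_part ?w \<in> R_vec"
    by (simp only:) (intro R_vec_diff Mat_R_R_vec MR diff_neg_part_in)
  then show "(case \<omega> of (y, z) \<Rightarrow> neg_part (matrix_inv h *v y + z)) \<in> V'"
    by (simp add: V'_def Vsp_iff[OF MR] \<omega>(1))
next
  fix j k
  obtain N where N: "\<And>i j k. k \<ge> int N \<Longrightarrow> h $ i $ j $$ k = 0" using degree_bound by blast
  let ?M = "vsig (Vsp (tI (int l) :: 'n Fmat)) \<Otimes>\<^sub>M vsig (Vsp h)"
  have inv: "(matrix_inv h *v y) $ j $$ k =
      (\<Sum>i\<in>UNIV. \<Sum>s\<in>{- int N..0}. flip_t (h $ i $ j) $$ s * y $ i $$ (k - s))" for y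
  proof -
    have "(flip_t (h $ i $ j) * y $ i) $$ k =
        (\<Sum>s\<in>{- int N..0}. flip_t (h $ i $ j) $$ s * y $ i $$ (k - s))" for i
      by (rule fls_times_nth_finite) (auto simp: flip_t_nth laurent N nonneg not_le)
    then show ?thesis by (simp add: inv_eq matrix_vector_mult_def fls_nth_sum)
  qed
  have "(\<lambda>\<omega>. if k < 0 then (\<Sum>i\<in>UNIV. \<Sum>s\<in>{- int N..0}. flip_t (h $ i $ j) $$ s * fst \<omega> $ i $$ (k - s)) + snd \<omega> $ j $$ k else 0)
      \<in> borel_measurable ?M"
    by measurable
  then show "(\<lambda>\<omega>. (case \<omega> of (y, z) \<Rightarrow> neg_part (matrix_inv h *v y + z)) $ j $$ k) \<in> borel_measurable ?M"
    by (cases "k < 0") (simp_all add: split_beta inv)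
qed

text \<open>The measure of the product is the image of the product measure under the principal part of
  \<open>h\<^sup>-\<^sup>1 y + z\<close>; so the integral over it is an iterated one.  The inner integral reproduces the Gaussian
  with the factor of \<open>(h, \<mu>)\<close>, the outer one reproduces it with the factor of \<open>t^l\<close>.\<close>

lemma rep_gaussian_convolution:
  fixes l :: nat
  assumes mu: "haar_measure (Vsp h) \<mu>"
    and lam: "lam > 0" and c: "c = lam powr (- 2 / real CARD('n))"
  shows "rep (Mhat_mult (tI_st l) (h, \<mu>)) (gaussian c) x =
    complex_of_real (lam ^ l) * rep (h, \<mu>) (gaussian c) x"
proof -
  define h' where "h' = tI (int l) ** h"
  define \<mu>1 where "\<mu>1 = induced_haar (Vsp (tI (int l) :: 'n Fmat))"
  let ?T = "\<lambda>(y, z). neg_part (matrix_inv h *v y + z)"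
  \<comment> \<open>Scalar loops are covered by the same analysis as \<open>h\<close> itself.\<close>
  interpret t: polynomial_loop "tI (int l) :: 'n Fmat" by (rule polynomial_loop_tI)
  have mu1: "haar_measure (Vsp (tI (int l))) \<mu>1" unfolding \<mu>1_def by (rule t.haar_induced)
  have l: "(\<integral>\<^sup>+y. ennreal (gauss c y) \<partial>\<mu>1) = ennreal (lam ^ l)"
    unfolding \<mu>1_def using t.nn_integral_induced[OF lam c det_tI] by simp
  interpret mu: sigma_finite_measure \<mu> by (rule haar_sigma_finite[OF mu])
  note [measurable_cong] = haar_sets[OF mu1] haar_sets[OF mu]
  have T [measurable]: "?T \<in> measurable (\<mu>1 \<Otimes>\<^sub>M \<mu>) (vsig (Vsp h'))"
    unfolding h'_def using convolution_measurable[of l] by (simp cong: measurable_cong_sets)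
  define D where "D = distr (\<mu>1 \<Otimes>\<^sub>M \<mu>) (vsig (Vsp h')) ?T"
  have nnD: "(\<integral>\<^sup>+w. f w \<partial>D) = (\<integral>\<^sup>+y. \<integral>\<^sup>+z. f (neg_part (matrix_inv h *v y + z)) \<partial>\<mu> \<partial>\<mu>1)"
    if f: "f \<in> borel_measurable (vsig (Vsp h'))" for f
  proof -
    note [measurable] = f
    have "(\<integral>\<^sup>+w. f w \<partial>D) = (\<integral>\<^sup>+p. f (?T p) \<partial>(\<mu>1 \<Otimes>\<^sub>M \<mu>))"
      unfolding D_def using f by (intro nn_integral_distr T) simp
    also have "\<dots> = (\<integral>\<^sup>+y. \<integral>\<^sup>+z. f (?T (y, z)) \<partial>\<mu> \<partial>\<mu>1)"
      by (rule mu.nn_integral_fst[symmetric]) measurable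
    finally show ?thesis by simp
  qed
  have "Mhat_mult (tI_st l) (h, \<mu>) = (h', D)"
  proof -
    have "measure_of (Vsp h') {U. openin (vtop (Vsp h')) U}
        (\<lambda>A. \<integral>\<^sup>+y. \<integral>\<^sup>+z. indicator A (neg_part (matrix_inv h *v y + z)) \<partial>\<mu> \<partial>\<mu>1) =
      measure_of (Vsp h') {U. openin (vtop (Vsp h')) U} (emeasure D)"
    proof (rule measure_of_eq[OF openin_vtop_Pow])
      fix A assume "A \<in> sigma_sets (Vsp h') {U. openin (vtop (Vsp h')) U}"
      then have A: "A \<in> sets (vsig (Vsp h'))" by (simp add: sets_vsig)
      then have "emeasure D A = (\<integral>\<^sup>+w. indicator A w \<partial>D)" by (simp add: D_def)
      also have "\<dots> = (\<integral>\<^sup>+y. \<integral>\<^sup>+z. indicator A (neg_part (matrix_inv h *v y + z)) \<partial>\<mu> \<partial>\<mu>1)"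
        by (rule nnD) (use A in measurable)
      finally show "(\<integral>\<^sup>+y. \<integral>\<^sup>+z. indicator A (neg_part (matrix_inv h *v y + z)) \<partial>\<mu> \<partial>\<mu>1) = emeasure D A" ..
    qed
    also have "\<dots> = D"
    proof (rule measure_eqI)
      have sD: "sets D = sigma_sets (Vsp h') {U. openin (vtop (Vsp h')) U}" by (simp add: D_def sets_vsig)
      then show s: "sets (measure_of (Vsp h') {U. openin (vtop (Vsp h')) U} (emeasure D)) = sets D"
        by (simp add: sets_measure_of[OF openin_vtop_Pow])
      fix A assume A: "A \<in> sets (measure_of (Vsp h') {U. openin (vtop (Vsp h')) U} (emeasure D))"
      show "emeasure (measure_of (Vsp h') {U. openin (vtop (Vsp h')) U} (emeasure D)) A = emeasure D A"
        using A emeasure_positive[of D] emeasure_countably_additive[of D]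
        by (intro emeasure_measure_of[OF refl openin_vtop_Pow]) (simp_all only: s)
    qed
    finally show ?thesis by (simp add: tI_st_def h'_def \<mu>1_def)
  qed
  moreover have "(\<integral>\<^sup>+w. ennreal (gauss c (matrix_inv h' *v x + w)) \<partial>D) =
      ennreal (lam ^ l) * (ennreal (gauss c x) * (\<integral>\<^sup>+z. ennreal (gauss c z) \<partial>\<mu>))"
  proof -
    have inv: "matrix_inv h' = matrix_inv h ** tI (- int l)"
    proof (rule matrix_inv_eq_right_inverse)
      have "h' ** (matrix_inv h ** tI (- int l)) = tI (int l) ** (h ** matrix_inv h) ** tI (- int l)"
        by (simp add: h'_def matrix_mul_assoc)
      then show "h' ** (matrix_inv h ** tI (- int l)) = mat 1"
        by (simp add: Mat_R_inverse[OF MatR] tI_tI tI_0)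
    qed
    have eq: "gauss c (matrix_inv h' *v x + neg_part (matrix_inv h *v y + z)) =
        gauss c (matrix_inv h *v (matrix_inv (tI (int l)) *v x + y) + z)" for y z
    proof -
      let ?w = "matrix_inv h *v y + z"
      have "matrix_inv h *v (matrix_inv (tI (int l)) *v x + y) + z = (matrix_inv h' *v x + neg_part ?w) + (?w - neg_part ?w)"
        by (simp add: inv matrix_inv_tI matrix_vector_mul_assoc[symmetric] matrix_vector_right_distrib)
      then show ?thesis by (simp only: gauss_def nsq_periodic[OF diff_neg_part_in])
    qed
    have "(\<integral>\<^sup>+w. ennreal (gauss c (matrix_inv h' *v x + w)) \<partial>D) =
        (\<integral>\<^sup>+y. \<integral>\<^sup>+z. ennreal (gauss c (matrix_inv h' *v x + neg_part (matrix_inv h *v y + z))) \<partial>\<mu> \<partial>\<mu>1)"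
      by (rule nnD) (rule measurable_compose[OF gauss_measurable measurable_ennreal], simp)
    also have "\<dots> = (\<integral>\<^sup>+y. ennreal (gauss c (matrix_inv (tI (int l)) *v x + y)) * (\<integral>\<^sup>+z. ennreal (gauss c z) \<partial>\<mu>) \<partial>\<mu>1)"
      unfolding eq by (simp only: nn_integral_gauss_inv[OF mu])
    also have "\<dots> = (\<integral>\<^sup>+y. ennreal (gauss c (matrix_inv (tI (int l)) *v x + y)) \<partial>\<mu>1) * (\<integral>\<^sup>+z. ennreal (gauss c z) \<partial>\<mu>)"
    proof (rule nn_integral_multc)
      show "(\<lambda>y. ennreal (gauss c (matrix_inv (tI (int l)) *v x + y))) \<in> borel_measurable \<mu>1"
        by (rule measurable_compose[OF gauss_measurable measurable_ennreal]) simp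
    qed
    also have "(\<integral>\<^sup>+y. ennreal (gauss c (matrix_inv (tI (int l)) *v x + y)) \<partial>\<mu>1) = ennreal (gauss c x) * ennreal (lam ^ l)"
      unfolding t.nn_integral_gauss_inv[OF mu1] l ..
    finally show ?thesis by (simp only: mult_ac)
  qed
  moreover have "sets D = sets (vsig (Vsp h'))" by (simp add: D_def)
  ultimately have "rep (Mhat_mult (tI_st l) (h, \<mu>)) (gaussian c) x =
      complex_of_real (enn2real (ennreal (lam ^ l) * (ennreal (gauss c x) * (\<integral>\<^sup>+z. ennreal (gauss c z) \<partial>\<mu>))))"
    by (simp only: rep_gaussian)
  then show ?thesis
    using lam gauss_pos[of c x]
    by (simp add: enn2real_mult rep_gaussian_haar[OF mu] gaussian_eq del: rep.simps)
qed

end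

section \<open>Gaussians are Schwartz functions\<close>

inductive polyfun :: "nat \<Rightarrow> ((nat \<Rightarrow> real) \<Rightarrow> real) \<Rightarrow> bool" for m where
  const: "polyfun m (\<lambda>a. r)"
| var: "i < m \<Longrightarrow> polyfun m (\<lambda>a. a i)"
| add: "polyfun m p \<Longrightarrow> polyfun m q \<Longrightarrow> polyfun m (\<lambda>a. p a + q a)"
| mult: "polyfun m p \<Longrightarrow> polyfun m q \<Longrightarrow> polyfun m (\<lambda>a. p a * q a)"

lemma polyfun_sum: "(\<And>l. l \<in> A \<Longrightarrow> polyfun m (p l)) \<Longrightarrow> polyfun m (\<lambda>a. \<Sum>l\<in>A. p l a)"
  by (induction A rule: infinite_finite_induct) (auto intro: polyfun.intros)

lemma polyfun_power: "polyfun m p \<Longrightarrow> polyfun m (\<lambda>a. p a ^ k)"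
  by (induction k) (auto intro: polyfun.intros)

lemma polyfun_prod: "(\<And>l. l \<in> A \<Longrightarrow> polyfun m (p l)) \<Longrightarrow> polyfun m (\<lambda>a. \<Prod>l\<in>A. p l a)"
  by (induction A rule: infinite_finite_induct) (auto intro: polyfun.intros)

lemma polyfun_continuous: "polyfun m p \<Longrightarrow> continuous_on UNIV p"
  by (induction rule: polyfun.induct) (auto intro: continuous_intros continuous_on_product_coordinates)

lemma polyfun_deriv:
  assumes "polyfun m p"
  shows "\<exists>q. polyfun m q \<and> (\<forall>a. ((\<lambda>s. p (a(i := s))) has_real_derivative q a) (at (a i)))"
  using assms
proof (induction rule: polyfun.induct)
  case (const r)
  then show ?case by (intro exI[of _ "\<lambda>a. 0"]) (auto intro: polyfun.const)
next
  case (var l)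
  then show ?case
    by (intro exI[of _ "\<lambda>a. if l = i then 1 else 0"]) (auto intro: polyfun.const)
next
  case (add p q)
  then obtain p' q' where *: "polyfun m p'" "polyfun m q'"
    "\<And>a. ((\<lambda>s. p (a(i := s))) has_real_derivative p' a) (at (a i))"
    "\<And>a. ((\<lambda>s. q (a(i := s))) has_real_derivative q' a) (at (a i))" by blast
  have "((\<lambda>s. p (a(i := s)) + q (a(i := s))) has_real_derivative (p' a + q' a)) (at (a i))" for a
    using DERIV_add[OF *(3)[of a] *(4)[of a]] .
  then show ?case using polyfun.add[OF *(1,2)] by blast
next
  case (mult p q)
  then obtain p' q' where *: "polyfun m p'" "polyfun m q'"
    "\<And>a. ((\<lambda>s. p (a(i := s))) has_real_derivative p' a) (at (a i))"
    "\<And>a. ((\<lambda>s. q (a(i := s))) has_real_derivative q' a) (at (a i))" by blast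
  have "polyfun m (\<lambda>a. p' a * q a + q' a * p a)"
    using * mult by (intro polyfun.intros)
  moreover have "((\<lambda>s. p (a(i := s)) * q (a(i := s))) has_real_derivative (p' a * q a + q' a * p a)) (at (a i))" for a
    using DERIV_mult[OF *(3)[of a] *(4)[of a]] by simp
  ultimately show ?case by blast
qed

text \<open>The form \<open>Q\<close> measures growth: polynomials are bounded by powers of \<open>1 + Q\<close> as soon as the coordinates
  are bounded by multiples of it.\<close>

lemma polyfun_bound:
  fixes Q :: "(nat \<Rightarrow> real) \<Rightarrow> real"
  assumes "polyfun m p" and Q: "\<And>a. 0 \<le> Q a"
    and coord: "\<And>i. i < m \<Longrightarrow> \<exists>K. \<forall>a. \<bar>a i\<bar> \<le> K * (1 + Q a)"
  shows "\<exists>K N. \<forall>a. \<bar>p a\<bar> \<le> K * (1 + Q a) ^ N"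
  using assms(1)
proof (induction rule: polyfun.induct)
  case (const r)
  show ?case by (intro exI[of _ "\<bar>r\<bar>"] exI[of _ 0]) simp
next
  case (var i)
  then obtain K where "\<forall>a. \<bar>a i\<bar> \<le> K * (1 + Q a)" using coord by blast
  then show ?case by (intro exI[of _ K] exI[of _ 1]) simp
next
  case (add p q)
  then obtain K N K' N' where *: "\<And>a. \<bar>p a\<bar> \<le> K * (1 + Q a) ^ N" "\<And>a. \<bar>q a\<bar> \<le> K' * (1 + Q a) ^ N'" by blast
  have "\<bar>p a + q a\<bar> \<le> (\<bar>K\<bar> + \<bar>K'\<bar>) * (1 + Q a) ^ (N + N')" for a
  proof -
    have "(1 + Q a) ^ N \<le> (1 + Q a) ^ (N + N')" "(1 + Q a) ^ N' \<le> (1 + Q a) ^ (N + N')"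
      using Q[of a] by (auto intro!: power_increasing)
    then have "\<bar>K\<bar> * (1 + Q a) ^ N \<le> \<bar>K\<bar> * (1 + Q a) ^ (N + N')" "\<bar>K'\<bar> * (1 + Q a) ^ N' \<le> \<bar>K'\<bar> * (1 + Q a) ^ (N + N')"
      by (auto intro: mult_left_mono)
    moreover have "K * (1 + Q a) ^ N \<le> \<bar>K\<bar> * (1 + Q a) ^ N" "K' * (1 + Q a) ^ N' \<le> \<bar>K'\<bar> * (1 + Q a) ^ N'"
      using Q[of a] by (auto intro!: mult_right_mono)
    ultimately show ?thesis using *(1)[of a] *(2)[of a] unfolding distrib_right by linarith
  qed
  then show ?case by blast
next
  case (mult p q)
  then obtain K N K' N' where *: "\<And>a. \<bar>p a\<bar> \<le> K * (1 + Q a) ^ N" "\<And>a. \<bar>q a\<bar> \<le> K' * (1 + Q a) ^ N'" by blast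
  have "\<bar>p a * q a\<bar> \<le> (K * K') * (1 + Q a) ^ (N + N')" for a
  proof -
    have "\<bar>p a\<bar> * \<bar>q a\<bar> \<le> (K * (1 + Q a) ^ N) * (K' * (1 + Q a) ^ N')"
      using *[of a] order_trans[OF abs_ge_zero *(1)[of a]] by (intro mult_mono) auto
    then show ?thesis by (simp add: abs_mult power_add mult_ac)
  qed
  then show ?case by blast
qed

lemma power_le_fact_exp:
  fixes x :: real
  assumes "0 \<le> x"
  shows "x ^ n \<le> fact n * exp x"
proof -
  have "x ^ n /\<^sub>R fact n \<le> (\<Sum>k. x ^ k /\<^sub>R fact k)"
    using sum_le_suminf[OF summable_exp_generic[of x], of "{n}"] assms by simp
  then have "x ^ n / fact n \<le> exp x" by (simp add: exp_def divide_inverse mult.commute)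
  then show ?thesis by (simp add: field_simps)
qed

definition poly_gauss :: "((nat \<Rightarrow> real) \<Rightarrow> real) \<Rightarrow> ((nat \<Rightarrow> real) \<Rightarrow> real) \<Rightarrow> (nat \<Rightarrow> real) \<Rightarrow> complex" where
  "poly_gauss Q p a = complex_of_real (p a * exp (- Q a))"

lemma poly_gauss_deriv:
  assumes "polyfun m Q" "polyfun m p"
  shows "\<exists>q. polyfun m q \<and> (\<forall>a. ((\<lambda>s. poly_gauss Q p (a(i := s))) has_vector_derivative poly_gauss Q q a) (at (a i)))"
proof -
  obtain Q' p' where *: "polyfun m Q'" "polyfun m p'"
    "\<And>a. ((\<lambda>s. Q (a(i := s))) has_real_derivative Q' a) (at (a i))"
    "\<And>a. ((\<lambda>s. p (a(i := s))) has_real_derivative p' a) (at (a i))"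
    using polyfun_deriv assms by metis
  define q where "q a = p' a + (-1) * (p a * Q' a)" for a
  have "polyfun m q" unfolding q_def using * assms by (intro polyfun.intros)
  moreover have "((\<lambda>s. poly_gauss Q p (a(i := s))) has_vector_derivative poly_gauss Q q a) (at (a i))" for a
  proof -
    have "((\<lambda>s. p (a(i := s)) * exp (- Q (a(i := s)))) has_real_derivative
        (p' a * exp (- Q a) + (exp (- Q a) * (- Q' a)) * p a)) (at (a i))"
      using DERIV_mult[OF *(4)[of a] DERIV_fun_exp[OF DERIV_minus[OF *(3)[of a]]]] by simp
    then have "((\<lambda>s. p (a(i := s)) * exp (- Q (a(i := s)))) has_real_derivative (q a * exp (- Q a))) (at (a i))"
      by (simp add: q_def algebra_simps)
    then show ?thesis
      unfolding poly_gauss_def has_real_derivative_iff_has_vector_derivative by (rule bounded_linear.has_vector_derivative[OF bounded_linear_of_real])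
  qed
  ultimately show ?thesis by blast
qed

text \<open>Partial derivatives stay within the class of polynomial multiples of \<open>exp (- Q)\<close>, and so does
  multiplication by monomials; it remains to bound the members of the class.\<close>

lemma schwartz_poly_gauss:
  assumes Qp: "polyfun m Q" and p: "polyfun m p" and Q: "\<And>a. 0 \<le> Q a"
    and coord: "\<And>i. i < m \<Longrightarrow> \<exists>K. \<forall>a. \<bar>a i\<bar> \<le> K * (1 + Q a)"
  shows "schwartz m (poly_gauss Q p)"
  unfolding schwartz_def
proof (intro allI impI)
  fix "is" :: "nat list" assume "set is \<subseteq> {..<m}"
  have "\<exists>q. polyfun m q \<and> foldr partial_deriv is (poly_gauss Q p) = poly_gauss Q q"
  proof (induction "is")
    case Nil
    then show ?case using p by auto
  next
    case (Cons i "is")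
    then obtain q where q: "polyfun m q" "foldr partial_deriv is (poly_gauss Q p) = poly_gauss Q q" by blast
    obtain q' where q': "polyfun m q'"
      "\<And>a. ((\<lambda>s. poly_gauss Q q (a(i := s))) has_vector_derivative poly_gauss Q q' a) (at (a i))"
      using poly_gauss_deriv[OF Qp q(1)] by blast
    have "partial_deriv i (poly_gauss Q q) = poly_gauss Q q'"
      unfolding partial_deriv_def using q'(2) by (intro ext vector_derivative_at)
    then show ?case using q q'(1) by auto
  qed
  then obtain q where q: "polyfun m q" "foldr partial_deriv is (poly_gauss Q p) = poly_gauss Q q" by blast
  show "continuous_on UNIV (foldr partial_deriv is (poly_gauss Q p)) \<and>
    (\<forall>i<m. \<forall>a. (\<lambda>s. foldr partial_deriv is (poly_gauss Q p) (a(i := s))) differentiable at (a i)) \<and>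
    (\<forall>e. bounded (range (\<lambda>a. (\<Prod>i<m. a i ^ e i) *\<^sub>R foldr partial_deriv is (poly_gauss Q p) a)))"
    unfolding q(2)
  proof (intro conjI allI impI)
    show "continuous_on UNIV (poly_gauss Q q)"
      unfolding poly_gauss_def using polyfun_continuous[OF q(1)] polyfun_continuous[OF Qp]
      by (intro continuous_intros)
  next
    fix i a
    show "(\<lambda>s. poly_gauss Q q (a(i := s))) differentiable at (a i)"
      using poly_gauss_deriv[OF Qp q(1), of i] differentiableI_vector by blast
  next
    fix e :: "nat \<Rightarrow> nat"
    have pq: "polyfun m (\<lambda>a. (\<Prod>i<m. a i ^ e i) * q a)"
      by (intro polyfun.mult polyfun_prod polyfun_power polyfun.var q(1)) auto
    obtain K N where KN: "\<And>a. \<bar>(\<Prod>i<m. a i ^ e i) * q a\<bar> \<le> K * (1 + Q a) ^ N"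
      using polyfun_bound[OF pq, of Q, OF Q coord] by blast
    have "norm ((\<Prod>i<m. a i ^ e i) *\<^sub>R poly_gauss Q q a) \<le> \<bar>K\<bar> * (fact N * exp 1)" for a
    proof -
      have "norm ((\<Prod>i<m. a i ^ e i) *\<^sub>R poly_gauss Q q a) = \<bar>(\<Prod>i<m. a i ^ e i) * q a\<bar> * exp (- Q a)"
        by (simp add: poly_gauss_def abs_mult norm_mult del: of_real_mult)
      also have "\<dots> \<le> (\<bar>K\<bar> * (1 + Q a) ^ N) * exp (- Q a)"
      proof (rule mult_right_mono)
        have "K * (1 + Q a) ^ N \<le> \<bar>K\<bar> * (1 + Q a) ^ N"
          using Q[of a] by (intro mult_right_mono) auto
        then show "\<bar>(\<Prod>i<m. a i ^ e i) * q a\<bar> \<le> \<bar>K\<bar> * (1 + Q a) ^ N" using KN[of a] by linarith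
      qed simp
      also have "\<dots> \<le> (\<bar>K\<bar> * (fact N * exp (1 + Q a))) * exp (- Q a)"
        using Q[of a] by (intro mult_right_mono mult_left_mono power_le_fact_exp) auto
      also have "\<dots> = \<bar>K\<bar> * (fact N * exp 1)"
        by (simp add: exp_add exp_minus)
      finally show ?thesis .
    qed
    then show "bounded (range (\<lambda>a. (\<Prod>i<m. a i ^ e i) *\<^sub>R poly_gauss Q q a))"
      by (auto simp: bounded_iff)
  qed
qed

text \<open>Positive definiteness of the squared norm in the coordinates of an arbitrary basis, made quantitative:
  the coordinates are fixed linear combinations of orthonormal ones.\<close>

lemma real_basis_coordinate_bound:
  fixes W :: "'n::finite Fvec set"
  assumes rb: "real_basis W m v" and W: "W \<subseteq> R_minus" and i: "i < m"
  shows "\<exists>K. \<forall>a. \<bar>a i\<bar> \<le> K * (1 + nsq (lincomb m v a))"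
proof -
  obtain w where w: "orthonormal_basis W m w" using real_basis_orthonormal[OF rb W] by blast
  interpret onb W m w by unfold_locales (use w W in auto)
  have vb: "inj_on v {..<m}" "rvs.independent (v ` {..<m})" "rvs.span (v ` {..<m}) = W"
    using rb by (auto simp: real_basis_def)
  have "\<exists>u. w l = (\<Sum>x\<in>v ` {..<m}. rscale (u x) x)" if "l < m" for l
    using basis_in[OF that] unfolding vb(3)[symmetric] by (auto simp: rvs.span_finite)
  then obtain S where S: "\<And>l. l < m \<Longrightarrow> w l = (\<Sum>x\<in>v ` {..<m}. rscale (S l x) x)" by metis
  have vW: "lincomb m v a \<in> W" for a
    unfolding lincomb_def vb(3)[symmetric] by (intro rvs.span_sum rvs.span_scale rvs.span_base) auto
  have bound: "\<bar>laurent_inner x (w l)\<bar> \<le> 1 + nsq x" if "x \<in> W" "l < m" for x l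
  proof -
    have "(laurent_inner x (w l))\<^sup>2 \<le> nsq x"
      unfolding nsq_expand[OF that(1)] using that(2) by (intro member_le_sum) auto
    moreover have "\<bar>t\<bar> \<le> 1 + t\<^sup>2" for t :: real
      using zero_le_power2[of "\<bar>t\<bar> - 1"] by (simp add: power2_eq_square algebra_simps abs_mult_self_eq)
    ultimately show ?thesis by (smt (verit))
  qed
  have "\<bar>a i\<bar> \<le> (\<Sum>l<m. \<bar>S l (v i)\<bar>) * (1 + nsq (lincomb m v a))" for a
  proof -
    let ?x = "lincomb m v a"
    let ?b = "\<lambda>y. \<Sum>l<m. laurent_inner ?x (w l) * S l y"
    define a' where "a' y = a (the_inv_into {..<m} v y)" for y
    have a': "a' (v j) = a j" if "j < m" for j
      unfolding a'_def using that by (simp add: the_inv_into_f_f[OF vb(1)])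
    have "?x = lincomb m w (\<lambda>l. laurent_inner ?x (w l))" by (simp add: expand vW)
    also have "\<dots> = (\<Sum>l<m. \<Sum>y\<in>v ` {..<m}. rscale (laurent_inner ?x (w l) * S l y) y)"
      unfolding lincomb_def by (intro sum.cong refl) (simp add: S rvs.scale_sum_right)
    also have "\<dots> = (\<Sum>y\<in>v ` {..<m}. \<Sum>l<m. rscale (laurent_inner ?x (w l) * S l y) y)"
      by (rule sum.swap)
    also have "\<dots> = (\<Sum>y\<in>v ` {..<m}. rscale (?b y) y)"
      by (simp add: rvs.scale_sum_left)
    finally have x1: "?x = (\<Sum>y\<in>v ` {..<m}. rscale (?b y) y)" .
    have x2: "?x = (\<Sum>y\<in>v ` {..<m}. rscale (a' y) y)"
      unfolding lincomb_def by (simp add: sum.reindex[OF vb(1)] a')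
    have "(\<Sum>y\<in>v ` {..<m}. rscale (a' y - ?b y) y) = 0"
      using x1 x2 by (simp only: rvs.scale_left_diff_distrib sum_subtractf diff_self)
    then have "a' (v i) - ?b (v i) = 0"
      using i by (intro rvs.independentD[OF vb(2), of "v ` {..<m}" "\<lambda>y. a' y - ?b y"]) auto
    then have "a i = ?b (v i)" using a'[OF i] by simp
    then have "\<bar>a i\<bar> \<le> (\<Sum>l<m. \<bar>laurent_inner ?x (w l) * S l (v i)\<bar>)"
      by simp
    also have "\<dots> \<le> (\<Sum>l<m. \<bar>S l (v i)\<bar> * (1 + nsq ?x))"
      by (intro sum_mono) (auto simp: abs_mult mult.commute intro!: mult_left_mono bound vW)
    finally show ?thesis by (simp add: sum_distrib_right)
  qed
  then show ?thesis by blast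
qed

lemma gaussian_schwartz:
  assumes "c > 0"
  shows "(gaussian c :: 'n::finite Fvec \<Rightarrow> complex) \<in> schwartz_space"
  unfolding schwartz_space_def
proof (rule CollectI, intro conjI allI ballI impI)
  fix x r :: "'n Fvec" assume "r \<in> R_vec"
  then show "gaussian c (x + r) = gaussian c x" by (simp add: gaussian_eq gauss_def nsq_periodic)
next
  fix W :: "'n Fvec set" and m v assume *: "W \<subseteq> R_minus \<and> real_basis W m v"
  then have rb: "real_basis W m v" and W: "W \<subseteq> R_minus" by auto
  obtain w where w: "orthonormal_basis W m w" using real_basis_orthonormal[OF rb W] by blast
  interpret onb W m w by unfold_locales (use w W in auto)
  define Q where "Q a = pi * c * nsq (lincomb m v a)" for a
  have vW: "lincomb m v a \<in> W" for a
  proof -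
    have "rvs.span (v ` {..<m}) = W" using rb by (simp add: real_basis_def)
    then show ?thesis
      unfolding lincomb_def by (auto intro!: rvs.span_sum rvs.span_scale intro: rvs.span_base)
  qed
  have "Q = (\<lambda>a. pi * c * (\<Sum>l<m. (\<Sum>i<m. a i * laurent_inner (v i) (w l))\<^sup>2))"
    unfolding Q_def nsq_expand[OF vW] by (simp add: lincomb_def laurent_inner_sum_left laurent_inner_rscale_left)
  then have Qp: "polyfun m Q"
    by (auto intro!: polyfun.mult polyfun.const polyfun_sum polyfun_power polyfun.var)
  have Q0: "0 \<le> Q a" for a using assms by (simp add: Q_def)
  have coord: "\<exists>K. \<forall>a. \<bar>a i\<bar> \<le> K * (1 + Q a)" if i: "i < m" for i
  proof -
    obtain K where K: "\<And>a. \<bar>a i\<bar> \<le> K * (1 + nsq (lincomb m v a))"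
      using real_basis_coordinate_bound[OF rb W i] by blast
    have "\<bar>a i\<bar> \<le> (\<bar>K\<bar> * (1 + 1 / (pi * c))) * (1 + Q a)" for a
    proof -
      have nsq: "nsq (lincomb m v a) = 1 / (pi * c) * Q a" using assms by (simp add: Q_def)
      have "K * (1 + nsq (lincomb m v a)) \<le> \<bar>K\<bar> * (1 + nsq (lincomb m v a))"
        by (intro mult_right_mono) (auto intro: add_nonneg_nonneg)
      also have "1 + nsq (lincomb m v a) \<le> (1 + 1 / (pi * c)) * (1 + Q a)"
        unfolding nsq using assms Q0[of a] by (simp add: algebra_simps add_divide_distrib)
      then have "\<bar>K\<bar> * (1 + nsq (lincomb m v a)) \<le> \<bar>K\<bar> * ((1 + 1 / (pi * c)) * (1 + Q a))"
        by (intro mult_left_mono) auto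
      finally show ?thesis using K[of a] by (simp add: mult.assoc)
    qed
    then show ?thesis by blast
  qed
  have "schwartz m (poly_gauss Q (\<lambda>a. 1))"
    by (rule schwartz_poly_gauss[OF Qp polyfun.const Q0 coord])
  moreover have "poly_gauss Q (\<lambda>a. 1) = (\<lambda>a. gaussian c (lincomb m v a))"
    by (simp add: poly_gauss_def gaussian_eq gauss_def Q_def fun_eq_iff)
  ultimately show "schwartz m (\<lambda>a. gaussian c (lincomb m v a))" by simp
qed

section \<open>The classes of the central extension\<close>

lemma tI_left_cancel:
  "tI a ** g = h \<longleftrightarrow> g = tI (- a) ** h"
  by (auto simp: matrix_mul_assoc tI_tI tI_0)

lemma polynomial_loop_shift:
  assumes "g \<in> O_grp" "tI k ** g \<in> Mat_R"
  shows "polynomial_loop (tI k ** g)"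
  by unfold_locales (simp_all add: assms unitary_loop_mult unitary_loop_tI O_grp_unitary)

text \<open>The matrix condition on \<open>a\<close> and on \<open>b\<close> is the same equation for \<open>h\<close>.  Under it \<open>h\<close> is a shift of \<open>g0\<close>, and the
  two eigenvalue conditions agree, as the eigenvalues for \<open>a\<close> and \<open>b\<close> differ by the factor that the exponents
  compensate.\<close>

lemma gen_rel_gaussian:
  fixes g0 :: "'n::finite Fmat"
  assumes lam: "lam > 0" and c: "c = lam powr (- 2 / real CARD('n))" and g0: "g0 \<in> O_grp"
  defines "P \<equiv> \<lambda>(k, \<alpha>). fst \<alpha> = tI (- k) ** g0 \<and>
    (\<lambda>x. complex_of_real (lam powi k) * rep \<alpha> (gaussian c) x) = (gaussian c :: 'n Fvec \<Rightarrow> complex)"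
  assumes "gen_rel a b"
  shows "P a \<longleftrightarrow> P b"
proof -
  from \<open>gen_rel a b\<close> obtain k l h \<mu> where
    ab: "a = (k + int l, (h, \<mu>))" "b = (k, Mhat_mult (tI_st l) (h, \<mu>))" "(h, \<mu>) \<in> Mhat0"
    unfolding gen_rel_def by force
  have h: "h \<in> Mat_R" and mu: "haar_measure (Vsp h) \<mu>" using ab(3) by (auto simp: Mhat0_def Mhat_def)
  have fst: "fst (Mhat_mult (tI_st l) (h, \<mu>)) = tI (int l) ** h" by (simp add: tI_st_def)
  have mat: "h = tI (- (k + int l)) ** g0 \<longleftrightarrow> tI (int l) ** h = tI (- k) ** g0"
    unfolding tI_left_cancel matrix_mul_assoc tI_tI by (simp add: add.commute)
  show ?thesis
  proof (cases "h = tI (- (k + int l)) ** g0")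
    case True
    interpret polynomial_loop h
      using polynomial_loop_shift[OF g0] True h by simp
    have "complex_of_real (lam powi k) * rep (Mhat_mult (tI_st l) (h, \<mu>)) (gaussian c) x =
        complex_of_real (lam powi (k + int l)) * rep (h, \<mu>) (gaussian c) x" for x
      using lam by (simp add: rep_gaussian_convolution[OF mu lam c] power_int_add del: rep.simps Mhat_mult.simps)
    then show ?thesis
      unfolding P_def ab using mat True fst by (simp del: rep.simps Mhat_mult.simps)
  next
    case False
    then show ?thesis unfolding P_def ab using mat fst by (simp del: rep.simps Mhat_mult.simps)
  qed
qed

lemma section_class:
  fixes g :: "'n::finite Fmat"
  assumes g: "g \<in> O_grp" and det: "det g = 1" and poly: "tI l ** g \<in> Mat_poly"
  shows "polynomial_loop (tI l ** g)"
    and "det (tI l ** g) = fls_X_intpow (int CARD('n) * l)"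
    and "(- l, (tI l ** g, induced_haar (Vsp (tI l ** g)))) \<in> Gtilde"
proof -
  let ?h = "tI l ** g"
  show det': "det ?h = fls_X_intpow (int CARD('n) * l)" by (simp add: det_mul det_tI det)
  have "?h \<in> Mat_R"
    using poly by (auto simp: Mat_R_def Mat_poly_def R_ring_def det') blast
  then show h: "polynomial_loop ?h" by (rule polynomial_loop_shift[OF g])
  then have "?h \<in> Mat_R" "haar_measure (Vsp ?h) (induced_haar (Vsp ?h))"
    by (auto simp: polynomial_loop_def intro: polynomial_loop.haar_induced)
  then show "(- l, (?h, induced_haar (Vsp ?h))) \<in> Gtilde"
    by (simp add: Gtilde_def Mhat0_def Mhat_def GL0_def det')
qed

theorem proposition3p1:
  fixes lam c :: real
  assumes "lam > 0"
    and "c = lam powr (- 2 / real CARD('n::finite))"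
  shows "(gaussian c :: 'n Fvec \<Rightarrow> complex) \<in> schwartz_eigenspace lam \<and>
    (K_grp :: (int \<times> ('n Fmat \<times> 'n Fvec measure)) set set) \<subseteq> SLhat \<and>
    (\<forall>k \<in> (K_grp :: (int \<times> ('n Fmat \<times> 'n Fvec measure)) set set).
       act lam k (gaussian c) = gaussian c)"
proof (intro conjI ballI subsetI)
  have c: "c > 0" using assms by simp
  have "rep (tI_st 1) (gaussian c) = (\<lambda>x :: 'n Fvec. complex_of_real lam * gaussian c x)"
  proof
    fix x :: "'n Fvec"
    interpret t: polynomial_loop "tI (int 1) :: 'n Fmat" by (rule polynomial_loop_tI)
    show "rep (tI_st 1) (gaussian c) x = complex_of_real lam * gaussian c x"
      unfolding tI_st_def t.rep_gaussian_haar[OF t.haar_induced] t.nn_integral_induced[OF assms det_tI]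
      using assms(1) by simp
  qed
  then show "(gaussian c :: 'n Fvec \<Rightarrow> complex) \<in> schwartz_eigenspace lam"
    using gaussian_schwartz[OF c] by (simp add: schwartz_eigenspace_def)
next
  fix C :: "(int \<times> ('n Fmat \<times> 'n Fvec measure)) set"
  assume "C \<in> K_grp"
  then obtain l and g :: "'n Fmat" where C: "C = ext_rel `` {(- l, (tI l ** g, induced_haar (Vsp (tI l ** g))))}"
    and g: "g \<in> O_grp" "det g = 1" "tI l ** g \<in> Mat_poly"
    by (auto simp: K_grp_def)
  define p where "p = (- l, (tI l ** g, induced_haar (Vsp (tI l ** g))))"
  have p: "p \<in> Gtilde" unfolding p_def by (rule section_class[OF g])
  then have pC: "p \<in> C" by (simp add: C p_def[symmetric] ext_rel_def)
  have "C \<in> GLhat" unfolding GLhat_def C p_def[symmetric] using p by (rule quotientI)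
  moreover have "det (tI (- l) ** (tI l ** g)) = 1"
    by (simp add: matrix_mul_assoc tI_tI tI_0 g)
  ultimately show "C \<in> SLhat"
    using pC unfolding SLhat_def p_def by blast
next
  fix C :: "(int \<times> ('n Fmat \<times> 'n Fvec measure)) set"
  assume "C \<in> K_grp"
  then obtain l and g :: "'n Fmat" where C: "C = ext_rel `` {(- l, (tI l ** g, induced_haar (Vsp (tI l ** g))))}"
    and g: "g \<in> O_grp" "det g = 1" "tI l ** g \<in> Mat_poly"
    by (auto simp: K_grp_def)
  define p where "p = (- l, (tI l ** g, induced_haar (Vsp (tI l ** g))))"
  have p: "p \<in> Gtilde" unfolding p_def by (rule section_class[OF g])
  then have pC: "p \<in> C" by (simp add: C p_def[symmetric] ext_rel_def)
  interpret h: polynomial_loop "tI l ** g" by (rule section_class[OF g])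
  \<comment> \<open>The matrix condition makes the Gaussian an eigenvector of every representative, also when the
    generating relation is followed backwards.\<close>
  define P where "P = (\<lambda>(k, \<alpha>). fst \<alpha> = tI (- k) ** g \<and>
    (\<lambda>x. complex_of_real (lam powi k) * rep \<alpha> (gaussian c) x) = (gaussian c :: 'n Fvec \<Rightarrow> complex))"
  have "complex_of_real (lam powi (- l)) * rep (tI l ** g, induced_haar (Vsp (tI l ** g))) (gaussian c) x = gaussian c x" for x
    unfolding h.rep_gaussian_haar[OF h.haar_induced] h.nn_integral_induced[OF assms section_class(2)[OF g]]
    using assms(1) by (simp add: power_int_minus)
  then have Pp: "P p" by (simp add: P_def p_def del: rep.simps)
  have P: "P q" if "q \<in> C" for q
  proof -
    have "equivclp gen_rel p q" using that by (simp add: C p_def[symmetric] ext_rel_def)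
    then show ?thesis
    proof (induction rule: equivclp_induct)
      case base
      show ?case by (rule Pp)
    next
      case (step y z)
      then show ?case
        using gen_rel_gaussian[OF assms g(1), folded P_def] by blast
    qed
  qed
  show "act lam C (gaussian c) = gaussian c"
    unfolding act_def
  proof (rule the_equality)
    show "\<exists>(l, \<alpha>)\<in>C. gaussian c = (\<lambda>x. complex_of_real (lam powi l) * rep \<alpha> (gaussian c) x)"
      using pC P[OF pC] by (intro bexI[of _ p]) (auto simp: P_def split: prod.splits simp del: rep.simps)
  next
    fix f assume "\<exists>(l, \<alpha>)\<in>C. f = (\<lambda>x. complex_of_real (lam powi l) * rep \<alpha> (gaussian c) x)"
    then obtain k \<alpha> where k: "(k, \<alpha>) \<in> C" "f = (\<lambda>x. complex_of_real (lam powi k) * rep \<alpha> (gaussian c) x)"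
      by blast
    then show "f = gaussian c" using P[OF k(1)] by (simp add: P_def del: rep.simps)
  qed
qed

end
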